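(* Let $N\ge 1$, let $\Omega\subset\mathbb{R}^N$ be a bounded domain, let $\{\lambda_i(\Omega)\}_{i\in\mathbb{N}}$ be the nondecreasing sequence of Dirichlet eigenvalues of the logarithmic Laplacian $L_\Delta$ in $\Omega$ (with $u=0$ in $\mathbb{R}^N\setminus\Omega$), and let $$d_N=\frac{2\omega_{N-1}}{N^2(2\pi)^N}.$$ Then: (i) for every integer $k\ge 1$, $$\sum_{i=1}^k\lambda_i(\Omega)\ge -d_N|\Omega|;$$ (ii) if $k>\frac{eNd_N}{2}|\Omega|$, then $$\sum_{i=1}^k\lambda_i(\Omega)>0;$$ (iii) if $k\ge \frac{e^{e+1}Nd_N}{2}|\Omega|$, then $$\sum_{i=1}^k\lambda_i(\Omega)\ge \frac{2k}{N}\left(\ln k+\ln\Big(\frac{2}{eNd_N|\Omega|}\Big)-\ln\ln\Big(\frac{2k}{eNd_N|\Omega|}\Big)\right).$$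
   Context: $|\Omega|$ is the Lebesgue measure of $\Omega$, and $\omega_{N-1}$ is the $(N-1)$-dimensional surface measure of the unit sphere $S^{N-1}\subset\mathbb{R}^N$. The logarithmic Laplacian is $$L_\Delta u(x)=c_N\int_{\mathbb{R}^N}\frac{u(x)1_{B_1(x)}(y)-u(y)}{|x-y|^N}\,dy+\rho_N u(x),$$ with $c_N=\pi^{-N/2}\Gamma(N/2)=\frac{2}{\omega_{N-1}}$ and $\rho_N=2\ln 2+\psi(\tfrac N2)-\gamma$, where $\gamma=-\Gamma'(1)$ and $\psi=\Gamma'/\Gamma$. Its Fourier symbol is $2\ln|\xi|$. $\mathbb{H}(\Omega)$ is the space of measurable $u:\mathbb{R}^N\to\mathbb{R}$ with $u\equiv0$ in $\mathbb{R}^N\setminus\Omega$ and $\iint_{|x-y|\le1}\frac{(u(x)-u(y))^2}{|x-y|^N}\,dx\,dy<+\infty$. It is a Hilbert space with inner product $$\mathcal{E}(u,w)=\frac{c_N}{2}\iint_{|x-y|\le 1}\frac{(u(x)-u(y))(w(x)-w(y))}{|x-y|^N}\,dx\,dy,$$ and embeds compactly in $L^2(\Omega)$ (functions in $L^2(\mathbb{R}^N)$ vanishing a.e. outside $\Omega$). The quadratic form of $L_\Delta$ on $\mathbb{H}(\Omega)$ is $$\mathcal{E}_L(u,w)=\mathcal{E}(u,w)-c_N\iint_{|x-y|\ge1}\frac{u(x)w(y)}{|x-y|^N}\,dx\,dy+\rho_N\int_{\mathbb{R}^N}uw\,dx .$$ A nonzero $u\in\mathbb{H}(\Omega)$ is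 an eigenfunction of the Dirichlet problem $L_\Delta u=\lambda u$ in $\Omega$, $u=0$ in $\mathbb{R}^N\setminus\Omega$, with eigenvalue $\lambda$, if $\mathcal{E}_L(u,\phi)=\lambda\int_\Omega u\phi\,dx$ for all $\phi\in\mathbb{H}(\Omega)$. It is known that there is a sequence of eigenvalues $\lambda_1(\Omega)<\lambda_2(\Omega)\le\lambda_3(\Omega)\le\cdots\to+\infty$ (repeated according to multiplicity) with eigenfunctions $\phi_i$ forming an orthonormal basis of $L^2(\Omega)$, and $$\lambda_i(\Omega)=\min\Big\{\mathcal{E}_L(u,u): u\in\mathbb{H}(\Omega),\ \|u\|_{L^2(\Omega)}=1,\ \int_\Omega u\phi_j\,dx=0\ \text{for } 1\le j\le i-1\Big\}.$$ *)

theory Defs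
  imports "HOL-Analysis.Analysis"
begin

text \<open>
  Throughout, the ambient space $R^N$ is a type \<open>'a::euclidean_space\<close> with \<open>N = DIM('a)\<close>.
  Functions are Lebesgue measurable, and the double integrals are Lebesgue integrals on
  \<open>'a \<times> 'a\<close>.
\<close>

definition c_const :: "'a::euclidean_space itself \<Rightarrow> real" where
  "c_const _ = pi powr (- real DIM('a) / 2) * Gamma (real DIM('a) / 2)"

definition rho_const :: "'a::euclidean_space itself \<Rightarrow> real" where
  "rho_const _ = 2 * ln 2 + Digamma (real DIM('a) / 2) - euler_mascheroni"

text \<open>
  The surface measure on the unit sphere, obtained from Lebesgue measure by polar coordinates:
  \<open>N\<close> times the volume of the open cone spanned by \<open>A\<close>.
\<close>

definition sphere_measure :: "'a::euclidean_space set \<Rightarrow> real" where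
  "sphere_measure A = real DIM('a) * measure lebesgue {r *\<^sub>R a | r a. 0 < r \<and> r < 1 \<and> a \<in> A}"

definition omega_const :: "'a::euclidean_space itself \<Rightarrow> real" where
  "omega_const _ = sphere_measure (sphere (0 :: 'a) 1)"

definition d_const :: "'a::euclidean_space itself \<Rightarrow> real" where
  "d_const _ = 2 * omega_const TYPE('a) / (real DIM('a) ^ 2 * (2 * pi) ^ DIM('a))"

lemma omega_const_eq:
  "omega_const TYPE('a::euclidean_space) = 2 * pi powr (real DIM('a) / 2) / Gamma (real DIM('a) / 2)"
proof -
  have "{r *\<^sub>R a | r a. 0 < r \<and> r < 1 \<and> a \<in> sphere (0 :: 'a) 1} = ball 0 1 - {0}" (is "?C = _")
  proof (intro set_eqI iffI)
    fix x :: 'a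
    assume "x \<in> ball 0 1 - {0}"
    then have "x = norm x *\<^sub>R (x /\<^sub>R norm x) \<and> 0 < norm x \<and> norm x < 1
        \<and> x /\<^sub>R norm x \<in> sphere 0 1"
      by (auto simp: divide_inverse)
    then show "x \<in> ?C" by blast
  qed auto
  moreover have "measure lebesgue (ball 0 1 - {0 :: 'a}) = measure lebesgue (ball (0 :: 'a) 1)"
    by (rule measure_Diff_null_set) auto
  ultimately have "omega_const TYPE('a) = real DIM('a) * unit_ball_vol (real DIM('a))"
    by (simp add: omega_const_def sphere_measure_def content_ball)
  moreover have "Gamma (real DIM('a) / 2 + 1) = real DIM('a) / 2 * Gamma (real DIM('a) / 2)"
    by (rule Gamma_plus1) (auto dest: nonpos_Ints_nonpos simp: not_le)
  ultimately show ?thesis by (simp add: unit_ball_vol_def)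
qed

lemma c_const_eq: "c_const TYPE('a::euclidean_space) = 2 / omega_const TYPE('a)"
  by (simp add: omega_const_eq c_const_def powr_minus divide_simps)

definition near_pairs :: "('a::euclidean_space \<times> 'a) set" where
  "near_pairs = {(x, y). norm (x - y) \<le> 1}"

definition far_pairs :: "('a::euclidean_space \<times> 'a) set" where
  "far_pairs = {(x, y). norm (x - y) \<ge> 1}"

text \<open>
  Elements of the Hilbert spaces below are represented by functions rather than classes
  modulo equality almost everywhere.
\<close>

definition H_space :: "'a::euclidean_space set \<Rightarrow> ('a \<Rightarrow> real) set" where
  "H_space \<Omega> = {u. u \<in> borel_measurable lebesgue \<and> (\<forall>x. x \<notin> \<Omega> \<longrightarrow> u x = 0) \<and>
     (\<integral>\<^sup>+(x, y)\<in>near_pairs. ennreal ((u x - u y)\<^sup>2 / norm (x - y) ^ DIM('a)) \<partial>lebesgue) < \<infinity>}"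

definition E_form :: "('a::euclidean_space \<Rightarrow> real) \<Rightarrow> ('a \<Rightarrow> real) \<Rightarrow> real" where
  "E_form u w = c_const TYPE('a) / 2 *
     (LINT (x, y):near_pairs|lebesgue. (u x - u y) * (w x - w y) / norm (x - y) ^ DIM('a))"

definition EL_form :: "('a::euclidean_space \<Rightarrow> real) \<Rightarrow> ('a \<Rightarrow> real) \<Rightarrow> real" where
  "EL_form u w = E_form u w
     - c_const TYPE('a) * (LINT (x, y):far_pairs|lebesgue. u x * w y / norm (x - y) ^ DIM('a))
     + rho_const TYPE('a) * (LINT x|lebesgue. u x * w x)"

definition is_eigenfunction :: "'a::euclidean_space set \<Rightarrow> real \<Rightarrow> ('a \<Rightarrow> real) \<Rightarrow> bool" where
  "is_eigenfunction \<Omega> \<mu> u \<longleftrightarrow>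
     u \<in> H_space \<Omega> \<and> \<not> (AE x in lebesgue. u x = 0) \<and>
     (\<forall>\<phi>\<in>H_space \<Omega>. EL_form u \<phi> = \<mu> * (LINT x:\<Omega>|lebesgue. u x * \<phi> x))"

definition L2_space :: "'a::euclidean_space set \<Rightarrow> ('a \<Rightarrow> real) set" where
  "L2_space \<Omega> = {f. f \<in> borel_measurable lebesgue \<and> (AE x in lebesgue. x \<notin> \<Omega> \<longrightarrow> f x = 0) \<and>
     integrable lebesgue (\<lambda>x. (f x)\<^sup>2)}"

definition L2_inner :: "'a::euclidean_space set \<Rightarrow> ('a \<Rightarrow> real) \<Rightarrow> ('a \<Rightarrow> real) \<Rightarrow> real" where
  "L2_inner \<Omega> f g = (LINT x:\<Omega>|lebesgue. f x * g x)"

text \<open>Sequences are indexed from 1; the value at 0 is irrelevant.\<close>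

definition L2_orthonormal_basis ::
    "'a::euclidean_space set \<Rightarrow> (nat \<Rightarrow> 'a \<Rightarrow> real) \<Rightarrow> bool" where
  "L2_orthonormal_basis \<Omega> \<phi> \<longleftrightarrow>
     (\<forall>i\<ge>1. \<phi> i \<in> L2_space \<Omega>) \<and>
     (\<forall>i\<ge>1. \<forall>j\<ge>1. L2_inner \<Omega> (\<phi> i) (\<phi> j) = (if i = j then 1 else 0)) \<and>
     (\<forall>f\<in>L2_space \<Omega>.
        (\<lambda>n. LINT x:\<Omega>|lebesgue. (f x - (\<Sum>i=1..n. L2_inner \<Omega> f (\<phi> i) * \<phi> i x))\<^sup>2)
          \<longlonglongrightarrow> 0)"

text \<open>
  \<open>dirichlet_eigenvalues \<Omega> lam\<close> says that \<open>lam 1 \<le> lam 2 \<le> \<dots>\<close> is the sequence of Dirichlet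
  eigenvalues. Since eigenfunctions for distinct eigenvalues are orthogonal, completeness of the
  system of eigenfunctions forces every eigenvalue to be listed exactly as often as its
  multiplicity, so that the sequence is determined by \<open>\<Omega>\<close>.
\<close>

definition dirichlet_eigenvalues :: "'a::euclidean_space set \<Rightarrow> (nat \<Rightarrow> real) \<Rightarrow> bool" where
  "dirichlet_eigenvalues \<Omega> lam \<longleftrightarrow>
     (\<forall>i\<ge>1. lam i \<le> lam (Suc i)) \<and>
     (\<exists>\<phi>. (\<forall>i\<ge>1. is_eigenfunction \<Omega> (lam i) (\<phi> i)) \<and> L2_orthonormal_basis \<Omega> \<phi>)"

end

theory Submission
  imports Defs "HOL-Probability.Characteristic_Functions"
begin

text \<open>
  Formally, the quadratic form of the logarithmic Laplacian is
  $(2\pi)^{-N} \int 2 \ln|\xi|\, |\hat u(\xi)|^2\, d\xi$. Summing it over the first $k$ orthonormal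
  eigenfunctions gives $\sum_{i \le k} \lambda_i = (2\pi)^{-N} \int 2 \ln|\xi|\, F(\xi)\, d\xi$ with
  $F = \sum_{i \le k} |\hat\phi_i|^2$. Bessel's inequality yields $0 \le F \le |\Omega|$, and the mass of
  $(2\pi)^{-N} F$ is $k$. As $\ln|\xi|$ is radially increasing, comparing it with a level $\ln R$
  (bathtub principle, as in the argument of Berezin and of Li and Yau) gives, for every $R > 0$,
  \[ \sum_{i \le k} \lambda_i \ge 2 k \ln R - d_N |\Omega| R^N , \]
  which is \<open>eigenvalue_sum_ge\<close>. The choice $R = 1$ proves (i). The optimal choice
  $R^N = 2k / (N d_N |\Omega|)$ gives the lower bound
  $\frac{2k}{N} \ln \frac{2k}{e N d_N |\Omega|}$ in \<open>eigenvalue_sum_ge_ln\<close>. It is positive in the range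
  of (ii), and it implies (iii) since the double logarithm subtracted there is nonnegative.

  The form is defined by singular integrals, so the work lies in connecting it with
  $\ln|\xi|$. The logarithmic Laplacian is the derivative at $s = 0$ of the powers of the Laplacian, and
  the proof uses the powers of order $-2s$ for small $s > 0$, that is, the Riesz form
  $\iint |x-y|^{2s-N} u(x) u(y)\, dx\, dy$. It is evaluated in two ways.

  \<^item> In frequency space (\<open>riesz_form_eq_power_spectrum\<close>) it is a multiple of
    $\int |\xi|^{-2s} |\hat u|^2$. Writing the Riesz kernel as an integral of heat kernels
    over time reduces this to the Fourier transform of the Gaussian and to Fubini's theorem. Together
    with the bathtub bound this estimates the sum over $i$ from above (\<open>riesz_form_sum_le\<close>).

  \<^item> In physical space (\<open>riesz_form_split\<close>) it is at least $\frac{\omega_{N-1}}{2s} \|u\|^2$ minus half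
    the near energy plus the far interaction.

  The terms of order $1/s$ cancel in the comparison of the two, what they leave behind is the constant
  $\rho_N$ (\<open>has_derivative_riesz_normalisation\<close>), and $s \to 0$ yields the
  logarithmic form (\<open>logarithmic_form_sum_ge\<close>).
\<close>

section \<open>Gamma and Gaussian integrals\<close>

lemma nn_integral_powr_exp:
  fixes s b :: real
  assumes "s > 0" "b > 0"
  shows "(\<integral>\<^sup>+t. ennreal (indicator {0<..} t * (t powr (s - 1) * exp (- b * t))) \<partial>lborel)
       = ennreal (Gamma s * b powr (- s))"
proof -
  have "ennreal (Gamma s) = (\<integral>\<^sup>+t. ennreal (indicator {0..} t * t powr (s - 1) / exp t) \<partial>lborel)"
    by (rule Gamma_conv_nn_integral_real) fact
  also have "\<dots> = ennreal b * (\<integral>\<^sup>+t. ennreal (indicator {0..} (b * t) * (b * t) powr (s - 1) / exp (b * t)) \<partial>lborel)"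
    by (subst nn_integral_real_affine[where c = b and t = 0]) (use assms in simp_all)
  also have "(\<integral>\<^sup>+t. ennreal (indicator {0..} (b * t) * (b * t) powr (s - 1) / exp (b * t)) \<partial>lborel)
      = (\<integral>\<^sup>+t. ennreal (b powr (s - 1)) * ennreal (indicator {0<..} t * (t powr (s - 1) * exp (- b * t))) \<partial>lborel)"
    by (intro nn_integral_cong)
       (use assms in \<open>auto simp: indicator_def powr_mult exp_minus field_simps zero_le_mult_iff
          simp flip: ennreal_mult'\<close>)
  also have "\<dots> = ennreal (b powr (s - 1)) * (\<integral>\<^sup>+t. ennreal (indicator {0<..} t * (t powr (s - 1) * exp (- b * t))) \<partial>lborel)"
    by (rule nn_integral_cmult) simp
  finally have "ennreal (Gamma s) = ennreal (b powr s) * (\<integral>\<^sup>+t. ennreal (indicator {0<..} t * (t powr (s - 1) * exp (- b * t))) \<partial>lborel)"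
    using assms by (simp add: mult.assoc[symmetric] powr_mult_base flip: ennreal_mult')
  then have "ennreal (b powr (- s)) * ennreal (Gamma s) = ennreal (b powr (- s)) * ennreal (b powr s) *
     (\<integral>\<^sup>+t. ennreal (indicator {0<..} t * (t powr (s - 1) * exp (- b * t))) \<partial>lborel)"
    by (simp add: mult.assoc)
  then show ?thesis
    using assms by (simp add: mult.commute flip: ennreal_mult' powr_add)
qed

text \<open>
  The substitution $t \mapsto 1/t$ turns the Gamma integral into the one that the time integral of
  the heat kernel leads to.
\<close>

lemma nn_integral_powr_exp_inverse:
  fixes s b :: real
  assumes "s > 0" "b > 0"
  shows "(\<integral>\<^sup>+t. ennreal (indicator {0<..} t * (t powr (- s - 1) * exp (- b / t))) \<partial>lborel)
       = ennreal (Gamma s * b powr (- s))"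
proof -
  define f where "f t = t powr (s - 1) * exp (- b * t)" for t
  define v where "v = Gamma s * b powr (- s)"
  have [measurable]: "f \<in> borel_measurable borel" unfolding f_def by measurable
  have v0: "v \<ge> 0" using assms by (simp add: v_def)
  have "((\<lambda>t. indicator {0<..} t * f t) has_integral v) UNIV"
    by (rule nn_integral_has_integral)
       (use v0 assms nn_integral_powr_exp[of s b] in \<open>simp_all add: f_def v_def\<close>)
  then have "(f has_integral v) {0<..}"
    by (subst has_integral_restrict_UNIV[symmetric]) (simp add: indicator_times_eq_if)
  then have f: "f absolutely_integrable_on {0<..}" "integral {0<..} f = v"
    by (auto intro!: nonnegative_absolutely_integrable_1 simp: f_def has_integral_iff)
  have img: "inverse ` {0<..} = ({0<..} :: real set)"
    by (force intro: image_eqI[of _ _ "inverse _"])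
  have "(\<lambda>x. \<bar>- inverse (x\<^sup>2)\<bar> * f (inverse x)) absolutely_integrable_on {0<..} \<and>
        integral {0<..} (\<lambda>x. \<bar>- inverse (x\<^sup>2)\<bar> * f (inverse x)) = v"
    by (subst has_absolute_integral_change_of_variables_1')
       (use f in \<open>auto simp: img inj_on_def power2_eq_square intro!: derivative_eq_intros\<close>)
  then have "((\<lambda>x. \<bar>- inverse (x\<^sup>2)\<bar> * f (inverse x)) has_integral v) {0<..}"
    using has_integral_iff set_lebesgue_integral_eq_integral(1) by blast
  also have "?this \<longleftrightarrow> ((\<lambda>t. t powr (- s - 1) * exp (- b / t)) has_integral v) {0<..}"
  proof (rule has_integral_cong)
    fix x :: real assume "x \<in> {0<..}"
    then have x: "x > 0" by simp
    have "inverse (x\<^sup>2) = x powr (-2)"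
      using x by (simp add: powr_minus)
    moreover have "inverse x powr (s - 1) = x powr (1 - s)"
      using x by (simp add: powr_minus[symmetric] inverse_powr)
    moreover have e: "- s - 1 = - 2 + (1 - s)" by simp
    ultimately show "\<bar>- inverse (x\<^sup>2)\<bar> * f (inverse x) = x powr (- s - 1) * exp (- b / x)"
      using x unfolding e powr_add by (simp add: f_def divide_inverse)
  qed
  finally show ?thesis
    using nn_integral_has_integral_lebesgue[of "{0<..}" "\<lambda>t. t powr (- s - 1) * exp (- b / t)" v]
    by (simp add: v_def)
qed

text \<open>
  The characteristic function of the standard normal distribution after the rescaling
  $x \mapsto \sqrt{2t}\, x$.
\<close>

lemma gaussian_iexp_real:
  fixes t z :: real
  assumes "t > 0"
  shows "integrable lborel (\<lambda>x. of_real (exp (- t * x\<^sup>2)) * iexp (z * x))" (is ?int)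
    and "(CLINT x|lborel. of_real (exp (- t * x\<^sup>2)) * iexp (z * x))
       = of_real (sqrt (pi / t) * exp (- z\<^sup>2 / (4 * t)))" (is ?val)
proof -
  \<comment> \<open>substituting $c x$ for the variable turns the standard normal density into the Gaussian $e^{-t x^2}$\<close>
  define c where "c = sqrt (2 * t)"
  have c: "c > 0" "c\<^sup>2 = 2 * t" using assms by (simp_all add: c_def)
  define \<tau> where "\<tau> = z / c"
  interpret normal: prob_space std_normal_distribution
    by (rule prob_space_normal_density) simp
  have "integrable std_normal_distribution (\<lambda>x. iexp (\<tau> * x))"
    by (rule normal.integrable_const_bound[where B = 1]) auto
  then have i: "integrable lborel (\<lambda>x. std_normal_density x *\<^sub>R iexp (\<tau> * x))"
    by (subst (asm) integrable_density) auto
  have v: "(CLINT x|lborel. std_normal_density x *\<^sub>R iexp (\<tau> * x)) = of_real (exp (- \<tau>\<^sup>2 / 2))"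
    using fun_cong[OF char_std_normal_distribution, of \<tau>]
    by (simp add: char_def integral_density)
  have eq: "std_normal_density (0 + c * x) *\<^sub>R iexp (\<tau> * (0 + c * x))
      = of_real (1 / sqrt (2 * pi)) * (of_real (exp (- t * x\<^sup>2)) * iexp (z * x))" for x
    using c by (simp add: std_normal_density_def \<tau>_def scaleR_conv_of_real power_mult_distrib)
  show ?int
    using integrable_mult_right[OF lborel_integrable_real_affine[OF i, of c 0], of "of_real (sqrt (2 * pi))"] c
    unfolding eq mult.assoc[symmetric] of_real_mult[symmetric] by simp
  have "of_real (exp (- \<tau>\<^sup>2 / 2)) =
      c *\<^sub>R (of_real (1 / sqrt (2 * pi)) * (CLINT x|lborel. of_real (exp (- t * x\<^sup>2)) * iexp (z * x)))"
    unfolding v[symmetric]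
    by (subst lborel_integral_real_affine[where c = c and t = 0])
       (use c in \<open>simp_all only: eq integral_mult_right_zero, simp_all\<close>)
  then have "(CLINT x|lborel. of_real (exp (- t * x\<^sup>2)) * iexp (z * x))
      = of_real (sqrt (2 * pi) / c * exp (- \<tau>\<^sup>2 / 2))"
    using c by (simp add: scaleR_conv_of_real field_simps)
  also have "sqrt (2 * pi) / c = sqrt (pi / t)"
    by (simp add: c_def real_sqrt_divide real_sqrt_mult)
  also have "- \<tau>\<^sup>2 / 2 = - z\<^sup>2 / (4 * t)"
    using c by (simp add: \<tau>_def power_divide)
  finally show ?val .
qed

text \<open>
  Both the Gaussian and the character factor over the coordinates, and Lebesgue measure is the
  product measure over \<open>Basis\<close>.
\<close>

lemma gaussian_iexp:
  fixes z :: "'a::euclidean_space"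
  assumes "t > 0"
  shows "integrable lborel (\<lambda>x::'a. of_real (exp (- t * (norm x)\<^sup>2)) * iexp (x \<bullet> z))" (is ?int)
    and "(CLINT x|lborel. of_real (exp (- t * (norm x)\<^sup>2)) * iexp (x \<bullet> z))
       = of_real ((pi / t) powr (real DIM('a) / 2) * exp (- (norm z)\<^sup>2 / (4 * t)))" (is ?val)
proof -
  interpret product_sigma_finite "\<lambda>_::'a. lborel :: real measure" ..
  define g where "g b x = of_real (exp (- t * x\<^sup>2)) * iexp ((z \<bullet> b) * x)" for b :: 'a and x :: real
  define S where "S f = (\<Sum>b\<in>Basis. f b *\<^sub>R b)" for f :: "'a \<Rightarrow> real"
  have S_b: "S f \<bullet> b = f b" if "b \<in> Basis" for f b
    using that by (simp add: S_def inner_sum_left inner_Basis if_distrib cong: if_cong)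
  have eq: "of_real (exp (- t * (norm (S f))\<^sup>2)) * iexp (S f \<bullet> z) = (\<Prod>b\<in>Basis. g b (f b))" for f
  proof -
    have "(norm (S f))\<^sup>2 = (\<Sum>b\<in>Basis. (f b)\<^sup>2)"
      unfolding power2_norm_eq_inner by (subst euclidean_inner) (simp add: S_b power2_eq_square)
    moreover have "S f \<bullet> z = (\<Sum>b\<in>Basis. (z \<bullet> b) * f b)"
      by (subst euclidean_inner) (simp add: S_b mult.commute)
    ultimately show ?thesis
      by (simp add: g_def prod.distrib sum_distrib_left exp_sum flip: sum_negf of_real_prod)
  qed
  have S_meas: "S \<in> measurable (Pi\<^sub>M Basis (\<lambda>b. lborel)) borel"
    unfolding S_def by measurable
  have gi: "integrable lborel (g b)" "integral\<^sup>L lborel (g b) = of_real (sqrt (pi / t) * exp (- (z \<bullet> b)\<^sup>2 / (4 * t)))"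
    for b unfolding g_def[abs_def] by (rule gaussian_iexp_real[OF assms])+
  have L: "lborel = distr (Pi\<^sub>M Basis (\<lambda>b::'a. lborel)) borel S"
    unfolding S_def by (rule lborel_eq)
  have "integrable (Pi\<^sub>M Basis (\<lambda>b. lborel)) (\<lambda>f. \<Prod>b\<in>Basis. g b (f b))"
    by (intro product_integrable_prod gi) simp
  then show ?int
    by (subst L, subst integrable_distr_eq[OF S_meas]) (simp, simp only: eq)
  have "(CLINT x|lborel. of_real (exp (- t * (norm x)\<^sup>2)) * iexp (x \<bullet> z)) =
      (CLINT f|Pi\<^sub>M Basis (\<lambda>b. lborel). \<Prod>b\<in>Basis. g b (f b))"
    by (subst L, subst integral_distr[OF S_meas]) (simp, simp only: eq)
  also have "\<dots> = (\<Prod>b\<in>Basis. integral\<^sup>L lborel (g b))"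
    by (intro product_integral_prod gi) simp
  also have "\<dots> = of_real (sqrt (pi / t) ^ DIM('a) * exp (\<Sum>b\<in>Basis. - (z \<bullet> b)\<^sup>2 / (4 * t)))"
    by (simp add: gi prod.distrib exp_sum)
  also have "(\<Sum>b\<in>Basis. - (z \<bullet> b)\<^sup>2 / (4 * t)) = - (norm z)\<^sup>2 / (4 * t)"
    unfolding power2_norm_eq_inner
    by (subst (2) euclidean_inner) (simp add: power2_eq_square sum_negf sum_divide_distrib)
  also have "sqrt (pi / t) ^ DIM('a) = (pi / t) powr (real DIM('a) / 2)"
    using assms by (simp add: powr_realpow[symmetric] powr_powr flip: powr_half_sqrt)
  finally show ?val .
qed

lemma gaussian_cos:
  fixes z :: "'a::euclidean_space"
  assumes "t > 0"
  shows "integrable lborel (\<lambda>x::'a. exp (- t * (norm x)\<^sup>2) * cos (x \<bullet> z))" (is ?int)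
    and "(LINT x|lborel. exp (- t * (norm x)\<^sup>2) * cos (x \<bullet> z))
       = (pi / t) powr (real DIM('a) / 2) * exp (- (norm z)\<^sup>2 / (4 * t))" (is ?val)
proof -
  have eq: "exp (- t * (norm x)\<^sup>2) * cos (x \<bullet> z) = Re (of_real (exp (- t * (norm x)\<^sup>2)) * iexp (x \<bullet> z))"
    for x by (simp add: Re_exp)
  show ?int
    unfolding eq by (intro integrable_Re gaussian_iexp assms)
  show ?val
    unfolding eq by (subst integral_Re) (simp_all only: gaussian_iexp[OF assms] Re_complex_of_real)
qed

section \<open>Radial integrals and the heat kernel\<close>

lemma omega_const_eq_unit_ball_vol:
  "omega_const TYPE('a::euclidean_space) = real DIM('a) * unit_ball_vol (real DIM('a))"
proof -
  have G: "Gamma (real DIM('a) / 2 + 1) = real DIM('a) / 2 * Gamma (real DIM('a) / 2)"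
    by (rule Gamma_plus1) (auto dest: nonpos_Ints_nonpos simp: not_le)
  show ?thesis
    unfolding omega_const_eq unit_ball_vol_def G by simp
qed

text \<open>
  Layer cake: $|x|^{-p} - R^{-p} = \int_{|x|}^R p\, r^{-p-1}\, dr$, so that the integral over the ball
  is $\int_0^R p\, r^{-p-1} |B_r|\, dr$. It serves twice: with $p = N - 2s$ for the mass of the Riesz
  kernel near the diagonal, and with $p = 2s$ for the bathtub bound in frequency space.
\<close>

lemma nn_integral_cball_powr_diff:
  fixes p R :: real
  assumes p: "0 < p" "p < real DIM('a::euclidean_space)" and R: "0 < R"
  shows "(\<integral>\<^sup>+(x::'a). ennreal (indicator (cball 0 R) x * (norm x powr (- p) - R powr (- p))) \<partial>lborel)
     = ennreal (unit_ball_vol (real DIM('a)) * p * R powr (real DIM('a) - p) / (real DIM('a) - p))"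
proof -
  define v where "v = unit_ball_vol (real DIM('a))"
  have v: "v \<ge> 0" by (simp add: v_def)
  define w where "w r = p * r powr (- p - 1)" for r :: real
  have w: "w r \<ge> 0" for r using p by (simp add: w_def)
  have [measurable]: "w \<in> borel_measurable borel" unfolding w_def by measurable
  have layer: "ennreal (indicator (cball 0 R) x * (norm x powr (- p) - R powr (- p)))
      = (\<integral>\<^sup>+r. ennreal (w r) * indicator {0<..R} r * indicator {(r, x). norm x \<le> r} (r, x) \<partial>lborel)"
    if "x \<noteq> 0" for x :: 'a
  proof (cases "norm x \<le> R")
    case True
    have "(\<integral>\<^sup>+r. ennreal (w r) * indicator {norm x..R} r \<partial>lborel)
        = ennreal (- (R powr (- p)) - (- (norm x powr (- p))))"
    proof (rule nn_integral_FTC_Icc)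
      fix r assume "r \<in> {norm x..R}"
      then have "r > 0" using that by (auto intro: less_le_trans[of 0 "norm x"])
      then show "((\<lambda>r. - (r powr (- p))) has_real_derivative w r) (at r)"
        by (auto intro!: derivative_eq_intros simp: w_def)
    qed (use True w in auto)
    moreover have "ennreal (w r) * indicator {0<..R} r * indicator {(r, x). norm x \<le> r} (r, x)
        = ennreal (w r) * indicator {norm x..R} r" for r
      using that by (auto simp: indicator_def intro: less_le_trans[of 0 "norm x"])
    ultimately show ?thesis using True by simp
  next
    case False
    then have Z: "ennreal (w r) * indicator {0<..R} r * indicator {(r, x). norm x \<le> r} (r, x) = 0" for r
      by (auto simp: indicator_def)
    show ?thesis unfolding Z using False by simp
  qed
  have "(\<integral>\<^sup>+(x::'a). ennreal (indicator (cball 0 R) x * (norm x powr (- p) - R powr (- p))) \<partial>lborel)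
      = (\<integral>\<^sup>+(x::'a). \<integral>\<^sup>+r. ennreal (w r) * indicator {0<..R} r * indicator {(r, x). norm x \<le> r} (r, x) \<partial>lborel \<partial>lborel)"
    by (rule nn_integral_cong_AE, use AE_lborel_singleton[of "0 :: 'a"] in eventually_elim, rule layer)
  also have "\<dots> = (\<integral>\<^sup>+r. \<integral>\<^sup>+(x::'a). ennreal (w r) * indicator {0<..R} r * indicator {(r, x). norm x \<le> r} (r, x) \<partial>lborel \<partial>lborel)"
    by (rule lborel_pair.Fubini') measurable
  also have "\<dots> = (\<integral>\<^sup>+r. ennreal (indicator {0..R} r * (v * p * r powr (real DIM('a) - p - 1))) \<partial>lborel)"
  proof (rule nn_integral_cong)
    fix r :: real
    have "(\<integral>\<^sup>+(x::'a). ennreal (w r) * indicator {0<..R} r * indicator {(r, x). norm x \<le> r} (r, x) \<partial>lborel)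
        = ennreal (w r) * indicator {0<..R} r * emeasure lborel (cball (0::'a) r)"
      by (subst nn_integral_cmult_indicator[symmetric]) (auto intro!: nn_integral_cong simp: indicator_def)
    also have "\<dots> = ennreal (indicator {0..R} r * (v * p * r powr (real DIM('a) - p - 1)))"
    proof (cases "0 < r \<and> r \<le> R")
      case True
      have e: "real DIM('a) - p - 1 = (- p - 1) + real DIM('a)" by simp
      from True have w_eq: "w r * (v * r ^ DIM('a)) = v * p * r powr (real DIM('a) - p - 1)"
        unfolding e powr_add by (simp add: w_def powr_realpow)
      have "emeasure lborel (cball (0::'a) r) = ennreal (v * r ^ DIM('a))"
        using True by (simp add: emeasure_cball v_def)
      then have "ennreal (w r) * indicator {0<..R} r * emeasure lborel (cball (0::'a) r)
          = ennreal (w r * (v * r ^ DIM('a)))"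
        using True v w by (simp add: ennreal_mult)
      then show ?thesis
        using True unfolding w_eq by simp
    next
      case False
      then show ?thesis by (auto simp: indicator_def)
    qed
    finally show "(\<integral>\<^sup>+(x::'a). ennreal (w r) * indicator {0<..R} r * indicator {(r, x). norm x \<le> r} (r, x) \<partial>lborel) = \<dots>" .
  qed
  also have "\<dots> = ennreal (v * p * (R powr (real DIM('a) - p) / (real DIM('a) - p)))"
  proof (rule nn_integral_has_integral_lebesgue)
    show "((\<lambda>r. v * p * r powr (real DIM('a) - p - 1)) has_integral
        v * p * (R powr (real DIM('a) - p) / (real DIM('a) - p))) {0..R}"
      using has_integral_powr_from_0[of "real DIM('a) - p - 1" R] p R
      by (intro has_integral_mult_right) simp
  qed (use v p in simp)
  finally show ?thesis by (simp add: v_def mult.assoc)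
qed

text \<open>
  On the unit ball $|z|^{2s-N} = (|z|^{2s-N} - 1) + 1$. The factor $1/s$ is the source of all
  singular terms in the limit $s \to 0$.
\<close>

lemma nn_integral_riesz_kernel_cball:
  fixes s :: real
  assumes s: "0 < s" "2 * s < real DIM('a::euclidean_space)"
  shows "(\<integral>\<^sup>+(z::'a). ennreal (indicator (cball 0 1) z * norm z powr (2 * s - real DIM('a))) \<partial>lborel)
     = ennreal (omega_const TYPE('a) / (2 * s))"
proof -
  define p where "p = real DIM('a) - 2 * s"
  define v where "v = unit_ball_vol (real DIM('a))"
  have v: "v \<ge> 0" by (simp add: v_def)
  have [measurable]: "cball (0::'a) 1 \<in> sets borel" by simp
  have "(\<integral>\<^sup>+(z::'a). ennreal (indicator (cball 0 1) z * norm z powr (- p)) \<partial>lborel)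
      = (\<integral>\<^sup>+(z::'a). ennreal (indicator (cball 0 1) z * (norm z powr (- p) - 1 powr (- p)))
            + indicator (cball 0 1) z \<partial>lborel)"
  proof (rule nn_integral_cong_AE, use AE_lborel_singleton[of "0 :: 'a"] in eventually_elim)
    case (elim z)
    then have "norm z powr (- p) \<ge> 1" if "norm z \<le> 1"
      using that s powr_mono2'[of "- p" "norm z" 1] by (simp add: p_def)
    then show "ennreal (indicator (cball 0 1) z * norm z powr (- p)) =
        ennreal (indicator (cball 0 1) z * (norm z powr (- p) - 1 powr (- p))) + indicator (cball 0 1) z"
      by (auto simp: indicator_def simp flip: ennreal_1 ennreal_plus)
  qed
  also have "\<dots> = ennreal (v * p / (real DIM('a) - p)) + ennreal v"
  proof (subst nn_integral_add)
    show "(\<integral>\<^sup>+(z::'a). ennreal (indicator (cball 0 1) z * (norm z powr (- p) - 1 powr (- p))) \<partial>lborel)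
        + (\<integral>\<^sup>+(z::'a). indicator (cball 0 1) z \<partial>lborel) = ennreal (v * p / (real DIM('a) - p)) + ennreal v"
      using s nn_integral_cball_powr_diff[of p 1, where 'a='a]
      by (simp add: p_def v_def emeasure_cball)
  qed measurable
  also have "\<dots> = ennreal (v * p / (real DIM('a) - p) + v)"
    using s v by (simp add: p_def)
  also have "v * p / (real DIM('a) - p) + v = omega_const TYPE('a) / (2 * s)"
    using s by (simp add: omega_const_eq_unit_ball_vol p_def v_def field_simps)
  finally show ?thesis by (simp add: p_def)
qed

definition heat_kernel :: "real \<Rightarrow> 'a::euclidean_space \<Rightarrow> real" where
  "heat_kernel t z = (4 * pi * t) powr (- real DIM('a) / 2) * exp (- (norm z)\<^sup>2 / (4 * t))"

text \<open>
  $\Gamma(s)$ times the usual normalisation of the Riesz potential of order $2s$. Unlike that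
  normalisation it is regular at $s = 0$, where it equals \<open>c_const\<close>.
\<close>

definition riesz_const :: "'a::euclidean_space itself \<Rightarrow> real \<Rightarrow> real" where
  "riesz_const _ s = pi powr (- real DIM('a) / 2) * 4 powr (- s) * Gamma (real DIM('a) / 2 - s)"

lemma heat_kernel_nonneg: "heat_kernel t z \<ge> 0"
  by (simp add: heat_kernel_def)

text \<open>
  Subordination: the Riesz kernel is a superposition of heat kernels. It carries the Gaussian
  Fourier transform over to a kernel that is not integrable.
\<close>

lemma nn_integral_heat_kernel_powr:
  fixes z :: "'a::euclidean_space"
  assumes s: "2 * s < real DIM('a)" and z: "z \<noteq> 0"
  shows "(\<integral>\<^sup>+t. ennreal (indicator {0<..} t * (t powr (s - 1) * heat_kernel t z)) \<partial>lborel)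
     = ennreal (riesz_const TYPE('a) s * norm z powr (2 * s - real DIM('a)))"
proof -
  define q where "q = real DIM('a) / 2 - s"
  define c where "c = (4 * pi) powr (- real DIM('a) / 2)"
  have q: "q > 0" using s by (simp add: q_def)
  have b: "(norm z)\<^sup>2 / 4 > 0" using z by simp
  have eq: "indicator {0<..} t * (t powr (s - 1) * heat_kernel t z)
      = c * (indicator {0<..} t * (t powr (- q - 1) * exp (- ((norm z)\<^sup>2 / 4) / t)))" for t :: real
  proof (cases "t > 0")
    case True
    have "- q - 1 = (s - 1) + (- real DIM('a) / 2)" by (simp add: q_def)
    with True show ?thesis
      by (simp only: powr_add) (simp add: heat_kernel_def c_def powr_mult)
  qed simp
  have "(\<integral>\<^sup>+t. ennreal (indicator {0<..} t * (t powr (s - 1) * heat_kernel t z)) \<partial>lborel)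
     = (\<integral>\<^sup>+t. ennreal c * ennreal (indicator {0<..} t * (t powr (- q - 1) * exp (- ((norm z)\<^sup>2 / 4) / t))) \<partial>lborel)"
    unfolding eq by (subst ennreal_mult') (simp_all add: c_def)
  also have "\<dots> = ennreal c * ennreal (Gamma q * ((norm z)\<^sup>2 / 4) powr (- q))"
    by (subst nn_integral_cmult) (simp_all only: nn_integral_powr_exp_inverse[OF q b], simp)
  also have "\<dots> = ennreal (c * (Gamma q * ((norm z)\<^sup>2 / 4) powr (- q)))"
    by (simp add: ennreal_mult' c_def)
  also have "((norm z)\<^sup>2 / 4) powr (- q) = norm z powr (2 * s - real DIM('a)) * 4 powr q"
  proof -
    have e: "2 * s - real DIM('a) = 2 * (- q)" by (simp add: q_def)
    have "(norm z)\<^sup>2 powr (- q) = norm z powr (2 * s - real DIM('a))"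
      using z unfolding e powr_powr[symmetric] by simp
    moreover have "((norm z)\<^sup>2 / 4) powr (- q) = (norm z)\<^sup>2 powr (- q) / 4 powr (- q)"
      by (rule powr_divide)
    moreover have "4 powr (- q) = inverse (4 powr q)"
      by (rule powr_minus)
    ultimately show ?thesis by (simp only: divide_inverse inverse_inverse_eq)
  qed
  also have "c * (Gamma q * (norm z powr (2 * s - real DIM('a)) * 4 powr q))
     = riesz_const TYPE('a) s * norm z powr (2 * s - real DIM('a))"
  proof -
    have "4 powr (- real DIM('a) / 2) * 4 powr q = 4 powr (- s)"
      unfolding powr_add[symmetric] by (simp add: q_def)
    then show ?thesis
      by (simp add: c_def riesz_const_def q_def powr_mult mult_ac)
  qed
  finally show ?thesis .
qed

text \<open>
  Fourier inversion for the Gaussian, read off from its Fourier transform since the transform is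
  again a Gaussian.
\<close>

lemma heat_kernel_fourier:
  fixes z :: "'a::euclidean_space"
  assumes "t > 0"
  shows "heat_kernel t z = (LINT \<xi>|lborel. exp (- t * (norm \<xi>)\<^sup>2) * cos (\<xi> \<bullet> z)) / (2 * pi) ^ DIM('a)"
proof -
  have "(pi / t) powr (real DIM('a) / 2) = (4 * pi * t) powr (- real DIM('a) / 2) * (2 * pi) ^ DIM('a)"
  proof -
    have "(2 * pi) ^ DIM('a) = ((2 * pi) powr 2) powr (real DIM('a) / 2)"
      by (simp add: powr_powr powr_realpow del: powr_numeral)
    also have "(2 * pi) powr 2 = (4 * pi * t) * (pi / t)"
      using assms by (simp add: power2_eq_square)
    also have "\<dots> powr (real DIM('a) / 2) = (4 * pi * t) powr (real DIM('a) / 2) * (pi / t) powr (real DIM('a) / 2)"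
      using assms by (intro powr_mult)
    finally show ?thesis
      using assms by (simp add: powr_minus)
  qed
  then show ?thesis
    unfolding gaussian_cos(2)[OF assms] by (simp add: heat_kernel_def)
qed

lemma nn_integral_heat_kernel:
  assumes "t > 0"
  shows "(\<integral>\<^sup>+(z::'a::euclidean_space). ennreal (heat_kernel t z) \<partial>lborel) = 1"
proof -
  \<comment> \<open>evaluate the Fourier integral of the Gaussian with parameter $1/(4t)$ at frequency zero\<close>
  have t: "1 / (4 * t) > 0" using assms by simp
  define c where "c = (4 * pi * t) powr (- real DIM('a) / 2)"
  have eq: "heat_kernel t z = c * (exp (- (1 / (4 * t)) * (norm z)\<^sup>2) * cos (z \<bullet> 0))" for z :: 'a
    by (simp add: heat_kernel_def c_def)
  have "integrable lborel (heat_kernel t :: 'a \<Rightarrow> real)"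
    unfolding eq[abs_def] by (intro integrable_mult_right gaussian_cos t)
  then have "(\<integral>\<^sup>+(z::'a). ennreal (heat_kernel t z) \<partial>lborel) = ennreal (LINT (z::'a)|lborel. heat_kernel t z)"
    by (rule nn_integral_eq_integral) (simp add: heat_kernel_nonneg)
  also have "(LINT (z::'a)|lborel. heat_kernel t z) = c * (pi / (1 / (4 * t))) powr (real DIM('a) / 2)"
    unfolding eq by (simp only: integral_mult_right_zero gaussian_cos(2)[OF t]) simp
  also have "\<dots> = 1"
    using assms by (simp add: c_def powr_minus field_simps)
  finally show ?thesis by simp
qed

section \<open>Double integrals of difference kernels\<close>

lemma nn_integral_lborel_reflect:
  fixes k :: "'a::euclidean_space \<Rightarrow> ennreal"
  assumes [measurable]: "k \<in> borel_measurable borel"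
  shows "(\<integral>\<^sup>+y. k (x - y) \<partial>lborel) = (\<integral>\<^sup>+z. k z \<partial>lborel)"
proof -
  have "(lborel :: 'a measure) = distr lborel borel (\<lambda>y. x - y)"
    by (subst lborel_affine[of "- 1" x]) (simp_all add: density_1)
  then have "(\<integral>\<^sup>+z. k z \<partial>lborel) = (\<integral>\<^sup>+z. k z \<partial>distr lborel borel (\<lambda>y. x - y))"
    by simp
  also have "\<dots> = (\<integral>\<^sup>+y. k (x - y) \<partial>lborel)"
    by (rule nn_integral_distr) simp_all
  finally show ?thesis by simp
qed

lemma nn_integral_lborel_translate:
  fixes k :: "'a::euclidean_space \<Rightarrow> ennreal"
  assumes [measurable]: "k \<in> borel_measurable borel"
  shows "(\<integral>\<^sup>+x. k (x - y) \<partial>lborel) = (\<integral>\<^sup>+z. k z \<partial>lborel)"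
proof -
  have "(\<integral>\<^sup>+z. k z \<partial>lborel) = (\<integral>\<^sup>+z. k z \<partial>distr lborel borel ((+) (- y)))"
    by (simp add: lborel_distr_plus)
  also have "\<dots> = (\<integral>\<^sup>+x. k (x - y) \<partial>lborel)"
    by (subst nn_integral_distr) (simp_all add: add.commute)
  finally show ?thesis by simp
qed

text \<open>
  One variable is integrated out by the invariance of Lebesgue measure under translation and reflection.
\<close>

lemma has_bochner_integral_diff_kernel:
  fixes k f :: "'a::euclidean_space \<Rightarrow> real"
  assumes [measurable]: "k \<in> borel_measurable borel" and k: "\<And>z. k z \<ge> 0"
    and \<kappa>: "(\<integral>\<^sup>+z. ennreal (k z) \<partial>lborel) = ennreal \<kappa>" "\<kappa> \<ge> 0"
    and f: "integrable lborel f" "\<And>x. f x \<ge> 0"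
  shows "has_bochner_integral lborel (\<lambda>(x, y). k (x - y) * f x) (\<kappa> * (LINT x|lborel. f x))" (is ?fst)
    and "has_bochner_integral lborel (\<lambda>(x, y). k (x - y) * f y) (\<kappa> * (LINT x|lborel. f x))" (is ?snd)
proof -
  have [measurable]: "f \<in> borel_measurable borel" using f(1) by simp
  have M: "(\<lambda>(x, y). k (x - y) * f x) \<in> borel_measurable lborel" "(\<lambda>(x, y). k (x - y) * f y) \<in> borel_measurable lborel"
    unfolding lborel_prod[symmetric] by measurable
  have F: "(\<integral>\<^sup>+x. ennreal (f x) \<partial>lborel) = ennreal (LINT x|lborel. f x)"
    by (rule nn_integral_eq_integral) (use f in auto)
  have int0: "(LINT x|lborel. f x) \<ge> 0" using f(2) by simp
  have "(\<integral>\<^sup>+p. ennreal (case p of (x, y) \<Rightarrow> k (x - y) * f x) \<partial>lborel)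
     = (\<integral>\<^sup>+x. \<integral>\<^sup>+y. ennreal (f x) * ennreal (k (x - y)) \<partial>lborel \<partial>lborel)"
    unfolding lborel_prod[symmetric]
    by (subst lborel.nn_integral_fst[symmetric])
       (use k f(2) in \<open>auto simp: ennreal_mult' mult.commute intro!: nn_integral_cong\<close>)
  also have "\<dots> = (\<integral>\<^sup>+x. ennreal (f x) * ennreal \<kappa> \<partial>lborel)"
    using nn_integral_lborel_reflect[of "\<lambda>z. ennreal (k z)"] by (simp add: nn_integral_cmult \<kappa>)
  also have "\<dots> = ennreal (\<kappa> * (LINT x|lborel. f x))"
    using \<kappa> int0 by (simp add: nn_integral_multc nn_integral_cmult F mult.commute flip: ennreal_mult)
  finally show ?fst
    by (intro has_bochner_integral_nn_integral M) (use k f(2) \<kappa> int0 in auto)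
  have "(\<integral>\<^sup>+p. ennreal (case p of (x, y) \<Rightarrow> k (x - y) * f y) \<partial>lborel)
     = (\<integral>\<^sup>+y. \<integral>\<^sup>+x. ennreal (f y) * ennreal (k (x - y)) \<partial>lborel \<partial>lborel)"
    unfolding lborel_prod[symmetric]
    by (subst lborel_pair.nn_integral_snd[symmetric])
       (use k f(2) in \<open>auto simp: ennreal_mult' mult.commute intro!: nn_integral_cong\<close>)
  also have "\<dots> = (\<integral>\<^sup>+x. ennreal (f x) * ennreal \<kappa> \<partial>lborel)"
    using nn_integral_lborel_translate[of "\<lambda>z. ennreal (k z)"] by (simp add: nn_integral_cmult \<kappa>)
  also have "\<dots> = ennreal (\<kappa> * (LINT x|lborel. f x))"
    using \<kappa> int0 by (simp add: nn_integral_multc nn_integral_cmult F mult.commute flip: ennreal_mult)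
  finally show ?snd
    by (intro has_bochner_integral_nn_integral M) (use k f(2) \<kappa> int0 in auto)
qed

lemma has_bochner_integral_lborel_times:
  fixes f :: "'a::euclidean_space \<Rightarrow> real" and g :: "'b::euclidean_space \<Rightarrow> real"
  assumes f: "integrable lborel f" and g: "integrable lborel g"
  shows "has_bochner_integral lborel (\<lambda>(x, y). f x * g y) ((LINT x|lborel. f x) * (LINT y|lborel. g y))"
proof -
  have [measurable]: "f \<in> borel_measurable borel" "g \<in> borel_measurable borel"
    using f g by simp_all
  have int: "integrable (lborel \<Otimes>\<^sub>M lborel) (\<lambda>(x, y). f x * g y)"
    by (rule lborel_pair.Fubini_integrable) (use f g in \<open>auto simp: abs_mult\<close>)
  then have "(\<integral>p. (case p of (x, y) \<Rightarrow> f x * g y) \<partial>(lborel \<Otimes>\<^sub>M lborel)) = (LINT x|lborel. LINT y|lborel. f x * g y)"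
    by (rule lborel_pair.integral_fst[symmetric])
  with int show ?thesis by (simp add: has_bochner_integral_iff lborel_prod)
qed

text \<open>
  For \<open>r = 0\<close> this discards the diagonal, for \<open>r = 1\<close> the overlap of \<open>near_pairs\<close> and \<open>far_pairs\<close>.
\<close>

lemma AE_lborel_dist_neq:
  "AE (x, y) in (lborel :: ('a::euclidean_space \<times> 'a) measure). norm (x - y) \<noteq> r"
proof -
  have "AE p in (lborel :: 'a measure) \<Otimes>\<^sub>M lborel. norm (fst p - snd p) \<noteq> r"
  proof (rule lborel_pair.AE_pair_measure)
    show "AE x in lborel. AE y in lborel. norm (fst (x, y) - snd (x, y :: 'a)) \<noteq> r"
    proof (rule AE_I2)
      fix x :: 'a
      have "sphere x r \<in> null_sets lborel"
        using negligible_sphere[of x r] by (simp add: negligible_iff_null_sets null_sets_completion_iff)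
      from AE_not_in[OF this] show "AE y in lborel. norm (fst (x, y) - snd (x, y)) \<noteq> r"
        by eventually_elim (simp add: dist_norm)
    qed
  qed measurable
  then show ?thesis unfolding lborel_prod split_beta .
qed

section \<open>Fourier representation of the heat and Riesz forms\<close>

text \<open>
  $|\hat u(\xi)|^2$ for $\hat u(\xi) = \int u(x) e^{-i \xi \cdot x}\, dx$, split into real and imaginary
  part.
\<close>

definition power_spectrum :: "('a::euclidean_space \<Rightarrow> real) \<Rightarrow> 'a \<Rightarrow> real" where
  "power_spectrum u \<xi> = (LINT x|lborel. u x * cos (\<xi> \<bullet> x))\<^sup>2 + (LINT x|lborel. u x * sin (\<xi> \<bullet> x))\<^sup>2"

lemma power_spectrum_nonneg: "power_spectrum u \<xi> \<ge> 0"
  by (simp add: power_spectrum_def)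

lemma power_spectrum_measurable [measurable]:
  assumes [measurable]: "u \<in> borel_measurable borel"
  shows "power_spectrum u \<in> borel_measurable borel"
  unfolding power_spectrum_def[abs_def] by measurable

text \<open>
  The addition theorem for $\cos(\xi \cdot x - \xi \cdot y)$.
\<close>

lemma power_spectrum_eq_double_integral:
  fixes u :: "'a::euclidean_space \<Rightarrow> real"
  assumes u: "integrable lborel u"
  shows "power_spectrum u \<xi> = (LINT (x, y)|lborel. cos (\<xi> \<bullet> (x - y)) * (u x * u y))"
proof -
  have [measurable]: "u \<in> borel_measurable borel" using u by simp
  have c: "integrable lborel (\<lambda>x. u x * cos (\<xi> \<bullet> x))" and s: "integrable lborel (\<lambda>x. u x * sin (\<xi> \<bullet> x))"
    by (rule Bochner_Integration.integrable_bound[OF u];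
        auto simp: abs_mult intro!: mult_left_le)+
  have "has_bochner_integral lborel
      (\<lambda>p. (case p of (x, y) \<Rightarrow> (u x * cos (\<xi> \<bullet> x)) * (u y * cos (\<xi> \<bullet> y)))
         + (case p of (x, y) \<Rightarrow> (u x * sin (\<xi> \<bullet> x)) * (u y * sin (\<xi> \<bullet> y)))) (power_spectrum u \<xi>)"
    unfolding power_spectrum_def power2_eq_square
    by (intro has_bochner_integral_add has_bochner_integral_lborel_times c s)
  also have "(\<lambda>p. (case p of (x, y) \<Rightarrow> (u x * cos (\<xi> \<bullet> x)) * (u y * cos (\<xi> \<bullet> y)))
         + (case p of (x, y) \<Rightarrow> (u x * sin (\<xi> \<bullet> x)) * (u y * sin (\<xi> \<bullet> y))))
      = (\<lambda>(x, y). cos (\<xi> \<bullet> (x - y)) * (u x * u y))"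
    by (auto simp: fun_eq_iff inner_diff_right cos_diff algebra_simps)
  finally show ?thesis
    by (simp add: has_bochner_integral_iff)
qed

text \<open>
  The Gaussian factor makes the triple integral over $(\xi, x, y)$ absolutely convergent, so that
  Fubini's theorem permits inserting the Fourier representation of the heat kernel.
\<close>

lemma heat_form_eq_power_spectrum:
  fixes u :: "'a::euclidean_space \<Rightarrow> real"
  assumes u: "integrable lborel u" and t: "t > 0"
  shows "integrable lborel (\<lambda>\<xi>. exp (- t * (norm \<xi>)\<^sup>2) * power_spectrum u \<xi>)" (is ?int)
    and "(LINT (x, y)|lborel. heat_kernel t (x - y) * (u x * u y))
      = (LINT \<xi>|lborel. exp (- t * (norm \<xi>)\<^sup>2) * power_spectrum u \<xi>) / (2 * pi) ^ DIM('a)" (is ?eq)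
proof -
  have [measurable]: "u \<in> borel_measurable borel" using u by simp
  \<comment> \<open>the integrand of the triple integral; its integral over the frequency gives the heat kernel, that over $(x, y)$ the spectrum\<close>
  define F where "F \<xi> p = (case p of (x, y) \<Rightarrow>
      exp (- t * (norm \<xi>)\<^sup>2) * cos (\<xi> \<bullet> (x - y)) * (u x * u y))" for \<xi> :: 'a and p :: "'a \<times> 'a"
  have gauss: "integrable lborel (\<lambda>\<xi>::'a. exp (- t * (norm \<xi>)\<^sup>2))"
    using gaussian_cos(1)[OF t, of "0 :: 'a"] by simp
  have uu: "integrable lborel (\<lambda>(x, y). u x * u y)"
    by (rule integrable.intros[OF has_bochner_integral_lborel_times[OF u u]])
  have "integrable lborel (\<lambda>(\<xi> :: 'a, p). exp (- t * (norm \<xi>)\<^sup>2) * (case p of (x, y) \<Rightarrow> u x * u y))"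
    by (rule integrable.intros[OF has_bochner_integral_lborel_times[OF gauss uu]])
  moreover have "(\<lambda>(\<xi>, p). F \<xi> p) \<in> borel_measurable lborel"
    unfolding F_def split_beta lborel_prod[symmetric] by measurable
  ultimately have "integrable lborel (\<lambda>(\<xi>, p). F \<xi> p)"
    by (rule Bochner_Integration.integrable_bound)
       (auto simp: F_def split_beta abs_mult intro!: mult_left_le_one_le)
  then have F: "integrable (lborel \<Otimes>\<^sub>M lborel) (\<lambda>(\<xi>, p). F \<xi> p)"
    by (simp add: lborel_prod)
  have F1: "(LINT p|lborel. F \<xi> p) = exp (- t * (norm \<xi>)\<^sup>2) * power_spectrum u \<xi>" for \<xi>
    unfolding power_spectrum_eq_double_integral[OF u] integral_mult_right_zero[symmetric]
    by (intro Bochner_Integration.integral_cong) (auto simp: F_def)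
  have F2: "(LINT \<xi>|lborel. F \<xi> p) = (2 * pi) ^ DIM('a) * (case p of (x, y) \<Rightarrow> heat_kernel t (x - y) * (u x * u y))" for p
  proof (cases p)
    case (Pair x y)
    have "(LINT \<xi>|lborel. F \<xi> p) = (LINT \<xi>|lborel. exp (- t * (norm \<xi>)\<^sup>2) * cos (\<xi> \<bullet> (x - y))) * (u x * u y)"
      by (simp add: F_def Pair)
    then show ?thesis
      by (simp add: Pair heat_kernel_fourier[OF t])
  qed
  show ?int
    using lborel_pair.integrable_fst[OF F] by (simp only: F1)
  show ?eq
    using lborel_pair.Fubini_integral[OF F] unfolding F1 F2 by (simp add: field_simps)
qed

text \<open>
  The heat kernel has mass one, and $u(x) u(y) \le (u(x)^2 + u(y)^2)/2$.
\<close>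

lemma heat_form_le:
  fixes u :: "'a::euclidean_space \<Rightarrow> real"
  assumes [measurable]: "u \<in> borel_measurable borel" and u2: "integrable lborel (\<lambda>x. (u x)\<^sup>2)" and t: "t > 0"
  shows "(LINT (x, y)|lborel. heat_kernel t (x - y) * (u x * u y)) \<le> (LINT x|lborel. (u x)\<^sup>2)"
proof -
  define A where "A = (LINT x|lborel. (u x)\<^sup>2)"
  have [measurable]: "(heat_kernel t :: 'a \<Rightarrow> real) \<in> borel_measurable borel"
    unfolding heat_kernel_def[abs_def] by measurable
  have mass: "(\<integral>\<^sup>+(z::'a). ennreal (heat_kernel t z) \<partial>lborel) = ennreal 1"
    using nn_integral_heat_kernel[OF t] by simp
  note K = has_bochner_integral_diff_kernel[OF _ heat_kernel_nonneg mass _ u2, simplified]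
  have sum: "has_bochner_integral lborel (\<lambda>p. ((case p of (x, y) \<Rightarrow> heat_kernel t (x - y) * (u x)\<^sup>2)
      + (case p of (x, y) \<Rightarrow> heat_kernel t (x - y) * (u y)\<^sup>2)) / 2) ((A + A) / 2)"
    unfolding A_def by (intro has_bochner_integral_divide_zero has_bochner_integral_add K)
  have "(LINT (x, y)|lborel. heat_kernel t (x - y) * (u x * u y)) \<le> (A + A) / 2"
    unfolding has_bochner_integral_integral_eq[OF sum, symmetric]
  proof (rule integral_mono')
    show "integrable lborel (\<lambda>p. ((case p of (x, y) \<Rightarrow> heat_kernel t (x - y) * (u x)\<^sup>2)
      + (case p of (x, y) \<Rightarrow> heat_kernel t (x - y) * (u y)\<^sup>2)) / 2)"
      using sum by (rule integrable.intros)
  next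
    fix p :: "'a \<times> 'a"
    obtain x y where p: "p = (x, y)" by (cases p)
    have "u x * u y \<le> ((u x)\<^sup>2 + (u y)\<^sup>2) / 2"
      using sum_squares_bound[of "u x" "u y"] by simp
    then have "heat_kernel t (x - y) * (u x * u y) \<le> heat_kernel t (x - y) * (((u x)\<^sup>2 + (u y)\<^sup>2) / 2)"
      by (rule mult_left_mono) (rule heat_kernel_nonneg)
    then show "(case p of (x, y) \<Rightarrow> heat_kernel t (x - y) * (u x * u y))
      \<le> ((case p of (x, y) \<Rightarrow> heat_kernel t (x - y) * (u x)\<^sup>2)
      + (case p of (x, y) \<Rightarrow> heat_kernel t (x - y) * (u y)\<^sup>2)) / 2"
      by (simp add: p algebra_simps)
    show "0 \<le> ((case p of (x, y) \<Rightarrow> heat_kernel t (x - y) * (u x)\<^sup>2)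
      + (case p of (x, y) \<Rightarrow> heat_kernel t (x - y) * (u y)\<^sup>2)) / 2"
      by (simp add: p heat_kernel_nonneg)
  qed
  then show ?thesis by (simp add: A_def)
qed

text \<open>
  One half of Plancherel's theorem: let $t \to 0$ in the bound for the heat form and apply Fatou's
  lemma. It limits the mass that the bathtub argument distributes.
\<close>

lemma power_spectrum_mass_le:
  fixes u :: "'a::euclidean_space \<Rightarrow> real"
  assumes u: "integrable lborel u" and u2: "integrable lborel (\<lambda>x. (u x)\<^sup>2)"
  shows "(\<integral>\<^sup>+\<xi>. ennreal (power_spectrum u \<xi>) \<partial>lborel) \<le> ennreal ((2 * pi) ^ DIM('a) * (LINT x|lborel. (u x)\<^sup>2))"
proof -
  have [measurable]: "u \<in> borel_measurable borel" using u by simp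
  define t where "t n = inverse (real (Suc n))" for n
  have t: "t n > 0" for n by (simp add: t_def)
  have t0: "t \<longlonglongrightarrow> 0" unfolding t_def by (rule LIMSEQ_inverse_real_of_nat)
  have "(\<integral>\<^sup>+\<xi>. ennreal (power_spectrum u \<xi>) \<partial>lborel)
     = (\<integral>\<^sup>+\<xi>. liminf (\<lambda>n. ennreal (exp (- t n * (norm \<xi>)\<^sup>2) * power_spectrum u \<xi>)) \<partial>lborel)"
  proof (rule nn_integral_cong)
    fix \<xi> :: 'a
    have "(\<lambda>n. ennreal (exp (- t n * (norm \<xi>)\<^sup>2) * power_spectrum u \<xi>)) \<longlonglongrightarrow>
        ennreal (exp (- 0 * (norm \<xi>)\<^sup>2) * power_spectrum u \<xi>)"
      by (intro tendsto_ennrealI tendsto_intros t0)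
    then show "ennreal (power_spectrum u \<xi>) = liminf (\<lambda>n. ennreal (exp (- t n * (norm \<xi>)\<^sup>2) * power_spectrum u \<xi>))"
      by (simp add: lim_imp_Liminf)
  qed
  also have "\<dots> \<le> liminf (\<lambda>n. \<integral>\<^sup>+\<xi>. ennreal (exp (- t n * (norm \<xi>)\<^sup>2) * power_spectrum u \<xi>) \<partial>lborel)"
    by (rule nn_integral_liminf) measurable
  also have "\<dots> \<le> liminf (\<lambda>n::nat. ennreal ((2 * pi) ^ DIM('a) * (LINT x|lborel. (u x)\<^sup>2)))"
  proof (intro Liminf_mono always_eventually allI)
    fix n
    have "(\<integral>\<^sup>+\<xi>. ennreal (exp (- t n * (norm \<xi>)\<^sup>2) * power_spectrum u \<xi>) \<partial>lborel)
      = ennreal (LINT \<xi>|lborel. exp (- t n * (norm \<xi>)\<^sup>2) * power_spectrum u \<xi>)"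
      by (rule nn_integral_eq_integral[OF heat_form_eq_power_spectrum(1)[OF u t]])
         (simp add: power_spectrum_nonneg)
    also have "(LINT \<xi>|lborel. exp (- t n * (norm \<xi>)\<^sup>2) * power_spectrum u \<xi>)
      \<le> (2 * pi) ^ DIM('a) * (LINT x|lborel. (u x)\<^sup>2)"
      using heat_form_le[OF _ u2 t[of n]] heat_form_eq_power_spectrum(2)[OF u t[of n]]
      by (simp add: pos_divide_le_eq mult.commute)
    finally show "(\<integral>\<^sup>+\<xi>. ennreal (exp (- t n * (norm \<xi>)\<^sup>2) * power_spectrum u \<xi>) \<partial>lborel)
      \<le> ennreal ((2 * pi) ^ DIM('a) * (LINT x|lborel. (u x)\<^sup>2))"
      by (simp add: ennreal_leI)
  qed
  also have "\<dots> = ennreal ((2 * pi) ^ DIM('a) * (LINT x|lborel. (u x)\<^sup>2))"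
    by (simp add: Liminf_const)
  finally show ?thesis .
qed

text \<open>
  Integrate the heat form identity against $t^{s-1}\, dt$. On the left subordination produces the
  Riesz kernel, on the right $\int_0^\infty t^{s-1} e^{-t|\xi|^2}\, dt = \Gamma(s) |\xi|^{-2s}$.
\<close>

lemma riesz_form_eq_power_spectrum:
  fixes u :: "'a::euclidean_space \<Rightarrow> real"
  assumes u: "integrable lborel u" and s: "0 < s" "2 * s < real DIM('a)"
    and int: "integrable lborel (\<lambda>(x, y). norm (x - y) powr (2 * s - real DIM('a)) * (u x * u y))"
  shows "ennreal (riesz_const TYPE('a) s * (LINT (x, y)|lborel. norm (x - y) powr (2 * s - real DIM('a)) * (u x * u y)))
     = (\<integral>\<^sup>+\<xi>. ennreal (Gamma s / (2 * pi) ^ DIM('a) * norm \<xi> powr (- 2 * s) * power_spectrum u \<xi>) \<partial>lborel)"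
proof -
  have [measurable]: "u \<in> borel_measurable borel" using u by simp
  define K where "K = (\<lambda>(x, y). norm (x - y) powr (2 * s - real DIM('a)) * (u x * u y))"
  define w where "w t = indicator {0<..} t * t powr (s - 1)" for t :: real
  have w: "w t \<ge> 0" for t by (simp add: w_def)
  have [measurable]: "w \<in> borel_measurable borel" unfolding w_def[abs_def] by measurable
  define G where "G t p = w t * (case p of (x, y) \<Rightarrow> heat_kernel t (x - y) * (u x * u y))"
    for t and p :: "'a \<times> 'a"
  have GM: "(\<lambda>(p, t). G t p) \<in> borel_measurable (lborel \<Otimes>\<^sub>M lborel)"
    unfolding G_def heat_kernel_def split_beta lborel_prod[symmetric] by measurable
  have c: "riesz_const TYPE('a) s \<ge> 0"
    using s by (simp add: riesz_const_def)
  have kernel: "(\<integral>\<^sup>+t. ennreal (w t * heat_kernel t z) \<partial>lborel)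
      = ennreal (riesz_const TYPE('a) s * norm z powr (2 * s - real DIM('a)))" if "z \<noteq> 0" for z :: 'a
    using nn_integral_heat_kernel_powr[OF s(2) that] by (simp add: w_def mult.assoc)
  have heat_M: "(\<lambda>t. heat_kernel t z) \<in> borel_measurable borel" for z :: 'a
    unfolding heat_kernel_def by measurable
  have AE_neq: "AE p in (lborel :: ('a \<times> 'a) measure). fst p \<noteq> snd p"
    using AE_lborel_dist_neq[of 0, where 'a='a] by (simp add: split_beta)
  have G_p: "(\<integral>\<^sup>+t. ennreal (norm (G t p)) \<partial>lborel) = ennreal (riesz_const TYPE('a) s * norm (K p))"
    "(LINT t|lborel. G t p) = riesz_const TYPE('a) s * K p" if "fst p \<noteq> snd p" for p
  proof -
    obtain x y where p: "p = (x, y)" by (cases p)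
    have z: "x - y \<noteq> 0" using that by (simp add: p)
    have "(\<integral>\<^sup>+t. ennreal (norm (G t p)) \<partial>lborel)
        = (\<integral>\<^sup>+t. ennreal (w t * heat_kernel t (x - y)) * ennreal \<bar>u x * u y\<bar> \<partial>lborel)"
      by (intro nn_integral_cong)
         (simp add: G_def p abs_mult w heat_kernel_nonneg mult.assoc flip: ennreal_mult')
    also have "\<dots> = ennreal (riesz_const TYPE('a) s * norm (x - y) powr (2 * s - real DIM('a))) * ennreal \<bar>u x * u y\<bar>"
      using heat_M by (subst nn_integral_multc) (simp_all add: kernel[OF z])
    also have "\<dots> = ennreal (riesz_const TYPE('a) s * norm (K p))"
      by (simp add: K_def p abs_mult mult.assoc flip: ennreal_mult'')
    finally show "(\<integral>\<^sup>+t. ennreal (norm (G t p)) \<partial>lborel) = ennreal (riesz_const TYPE('a) s * norm (K p))" .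
    have "has_bochner_integral lborel (\<lambda>t. w t * heat_kernel t (x - y))
        (riesz_const TYPE('a) s * norm (x - y) powr (2 * s - real DIM('a)))"
      by (rule has_bochner_integral_nn_integral)
         (use heat_M c in \<open>simp_all add: kernel[OF z] w heat_kernel_nonneg\<close>)
    then have "has_bochner_integral lborel (\<lambda>t. w t * heat_kernel t (x - y) * (u x * u y))
        (riesz_const TYPE('a) s * norm (x - y) powr (2 * s - real DIM('a)) * (u x * u y))"
      by (rule has_bochner_integral_mult_left)
    then show "(LINT t|lborel. G t p) = riesz_const TYPE('a) s * K p"
      by (simp add: has_bochner_integral_iff G_def K_def p mult.assoc)
  qed
  \<comment> \<open>by Tonelli with the time integral inside, absolute integrability reduces to that of the Riesz form\<close>
  have G: "integrable (lborel \<Otimes>\<^sub>M lborel) (\<lambda>(p, t). G t p)"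
  proof (rule integrableI_bounded)
    show "(\<lambda>(p, t). G t p) \<in> borel_measurable (lborel \<Otimes>\<^sub>M lborel)" by (rule GM)
    have "(\<integral>\<^sup>+q. ennreal (norm (case q of (p, t) \<Rightarrow> G t p)) \<partial>(lborel \<Otimes>\<^sub>M lborel))
        = (\<integral>\<^sup>+p. \<integral>\<^sup>+t. ennreal (norm (G t p)) \<partial>lborel \<partial>lborel)"
      using GM by (subst lborel.nn_integral_fst[symmetric]) (simp_all add: split_beta)
    also have "\<dots> = (\<integral>\<^sup>+p. ennreal (norm (riesz_const TYPE('a) s * K p)) \<partial>lborel)"
      by (rule nn_integral_cong_AE, use AE_neq in eventually_elim) (subst G_p(1), assumption, simp add: abs_mult c)
    also have "\<dots> < \<infinity>"
      using integrable_mult_right[OF int, of "riesz_const TYPE('a) s"]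
      unfolding integrable_iff_bounded K_def[symmetric] by simp
    finally show "(\<integral>\<^sup>+q. ennreal (norm (case q of (p, t) \<Rightarrow> G t p)) \<partial>(lborel \<Otimes>\<^sub>M lborel)) < \<infinity>" .
  qed
  define H where "H t = (LINT \<xi>|lborel. exp (- t * (norm \<xi>)\<^sup>2) * power_spectrum u \<xi>) / (2 * pi) ^ DIM('a)" for t
  have G_t: "(LINT p|lborel. G t p) = w t * H t" for t
  proof (cases "t > 0")
    case True
    then show ?thesis
      by (simp add: G_def H_def heat_form_eq_power_spectrum(2)[OF u] del: times_divide_eq_right)
  qed (simp add: G_def w_def)
  have H: "ennreal (w t * H t) = (\<integral>\<^sup>+\<xi>. ennreal (w t * exp (- t * (norm \<xi>)\<^sup>2) * (power_spectrum u \<xi> / (2 * pi) ^ DIM('a))) \<partial>lborel)" for t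
  proof (cases "t > 0")
    case True
    have i: "integrable lborel (\<lambda>\<xi>. w t * exp (- t * (norm \<xi>)\<^sup>2) * (power_spectrum u \<xi> / (2 * pi) ^ DIM('a)))"
      using integrable_mult_right[OF heat_form_eq_power_spectrum(1)[OF u True], of "w t / (2 * pi) ^ DIM('a)"]
      by (simp add: mult.assoc)
    have "w t * H t = (LINT \<xi>|lborel. w t / (2 * pi) ^ DIM('a) * (exp (- t * (norm \<xi>)\<^sup>2) * power_spectrum u \<xi>))"
      by (simp add: H_def)
    also have "\<dots> = (LINT \<xi>|lborel. w t * exp (- t * (norm \<xi>)\<^sup>2) * (power_spectrum u \<xi> / (2 * pi) ^ DIM('a)))"
      by (rule Bochner_Integration.integral_cong) simp_all
    finally show ?thesis
      by (simp only:) (rule nn_integral_eq_integral[OF i, symmetric], simp add: w power_spectrum_nonneg)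
  qed (simp add: w_def)
  have H0: "H t \<ge> 0" for t
    by (simp add: H_def power_spectrum_nonneg)
  have "riesz_const TYPE('a) s * (LINT p|lborel. K p) = (LINT p|lborel. LINT t|lborel. G t p)"
    unfolding integral_mult_right_zero[symmetric]
  proof (rule integral_cong_AE)
    show "(\<lambda>p. LINT t|lborel. G t p) \<in> borel_measurable lborel"
      using lborel_pair.integrable_fst[OF G] by simp
    show "(\<lambda>p. riesz_const TYPE('a) s * K p) \<in> borel_measurable lborel"
      using int unfolding K_def[symmetric] by simp
    show "AE p in lborel. riesz_const TYPE('a) s * K p = (LINT t|lborel. G t p)"
      using AE_neq by eventually_elim (simp add: G_p)
  qed
  also have "\<dots> = (LINT t|lborel. w t * H t)"
    using lborel_pair.Fubini_integral[OF G] by (simp add: G_t)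
  finally have "ennreal (riesz_const TYPE('a) s * (LINT p|lborel. K p)) = ennreal (LINT t|lborel. w t * H t)"
    by simp
  also have "\<dots> = (\<integral>\<^sup>+t. ennreal (w t * H t) \<partial>lborel)"
    using lborel_pair.integrable_snd[OF G]
    by (intro nn_integral_eq_integral[symmetric]) (simp_all add: G_t w H0)
  also have "\<dots> = (\<integral>\<^sup>+t. \<integral>\<^sup>+\<xi>. ennreal (w t * exp (- t * (norm \<xi>)\<^sup>2) * (power_spectrum u \<xi> / (2 * pi) ^ DIM('a))) \<partial>lborel \<partial>lborel)"
    by (simp only: H)
  also have "\<dots> = (\<integral>\<^sup>+\<xi>. \<integral>\<^sup>+t. ennreal (w t * exp (- t * (norm \<xi>)\<^sup>2) * (power_spectrum u \<xi> / (2 * pi) ^ DIM('a))) \<partial>lborel \<partial>lborel)"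
    by (rule lborel_pair.Fubini') measurable
  also have "\<dots> = (\<integral>\<^sup>+\<xi>. ennreal (Gamma s / (2 * pi) ^ DIM('a) * norm \<xi> powr (- 2 * s) * power_spectrum u \<xi>) \<partial>lborel)"
  proof (rule nn_integral_cong_AE, use AE_lborel_singleton[of "0 :: 'a"] in eventually_elim)
    case (elim \<xi>)
    then have b: "(norm \<xi>)\<^sup>2 > 0" by simp
    have sq: "((norm \<xi>)\<^sup>2) powr (- s) = norm \<xi> powr (- 2 * s)"
    proof -
      have e: "- 2 * s = 2 * (- s)" by simp
      show ?thesis using elim unfolding e powr_powr[symmetric] by simp
    qed
    have "(\<integral>\<^sup>+t. ennreal (w t * exp (- t * (norm \<xi>)\<^sup>2) * (power_spectrum u \<xi> / (2 * pi) ^ DIM('a))) \<partial>lborel)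
       = (\<integral>\<^sup>+t. ennreal (w t * exp (- t * (norm \<xi>)\<^sup>2)) * ennreal (power_spectrum u \<xi> / (2 * pi) ^ DIM('a)) \<partial>lborel)"
      by (simp add: ennreal_mult'' power_spectrum_nonneg del: times_divide_eq_right)
    also have "\<dots> = ennreal (Gamma s * ((norm \<xi>)\<^sup>2) powr (- s)) * ennreal (power_spectrum u \<xi> / (2 * pi) ^ DIM('a))"
      using nn_integral_powr_exp[OF s(1) b]
      by (subst nn_integral_multc) (simp_all add: w_def mult.assoc mult.commute[of "(norm \<xi>)\<^sup>2"])
    also have "\<dots> = ennreal (Gamma s / (2 * pi) ^ DIM('a) * norm \<xi> powr (- 2 * s) * power_spectrum u \<xi>)"
      unfolding sq by (simp add: power_spectrum_nonneg mult_ac flip: ennreal_mult'')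
    finally show ?case .
  qed
  finally show ?thesis by (simp only: K_def)
qed

section \<open>Riesz form versus the near and far parts of the logarithmic form\<close>

lemma near_pairs_measurable [measurable]: "near_pairs \<in> sets (lborel :: ('a::euclidean_space \<times> 'a) measure)"
proof -
  have "near_pairs = {p :: 'a \<times> 'a. norm (fst p - snd p) \<le> 1}"
    by (auto simp: near_pairs_def)
  moreover have "closed \<dots>"
    by (intro closed_Collect_le continuous_intros)
  ultimately show ?thesis by simp
qed

lemma far_pairs_measurable [measurable]: "far_pairs \<in> sets (lborel :: ('a::euclidean_space \<times> 'a) measure)"
proof -
  have "far_pairs = {p :: 'a \<times> 'a. 1 \<le> norm (fst p - snd p)}"
    by (auto simp: far_pairs_def)
  moreover have "closed \<dots>"
    by (intro closed_Collect_le continuous_intros)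
  ultimately show ?thesis by simp
qed

definition near_energy_density :: "('a::euclidean_space \<Rightarrow> real) \<Rightarrow> 'a \<times> 'a \<Rightarrow> real" where
  "near_energy_density u = (\<lambda>(x, y). indicator near_pairs (x, y) * ((u x - u y)\<^sup>2 / norm (x - y) ^ DIM('a)))"

text \<open>
  For $s = 0$ this is the far kernel of the logarithmic Laplacian, for $s > 0$ the Riesz kernel cut
  off to the far pairs.
\<close>

definition far_form_density :: "real \<Rightarrow> ('a::euclidean_space \<Rightarrow> real) \<Rightarrow> 'a \<times> 'a \<Rightarrow> real" where
  "far_form_density s u = (\<lambda>(x, y). indicator far_pairs (x, y) * (norm (x - y) powr (2 * s - real DIM('a)) * (u x * u y)))"

lemma far_form_density_measurable:
  assumes [measurable]: "u \<in> borel_measurable borel"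
  shows "far_form_density s u \<in> borel_measurable lborel"
proof -
  have [measurable]: "far_pairs \<in> sets (lborel \<Otimes>\<^sub>M lborel)" by (simp only: lborel_prod far_pairs_measurable)
  show ?thesis
    unfolding far_form_density_def split_beta prod.collapse lborel_prod[symmetric] by measurable
qed

text \<open>
  As the exponent $2s - N$ is not positive, $|u(x) u(y)|$ dominates the far part uniformly in $s$.
\<close>

lemma far_form_density_le:
  assumes "2 * s \<le> real DIM('a)"
  shows "norm (far_form_density s u (x, y :: 'a::euclidean_space)) \<le> norm (u x * u y)"
proof -
  have "norm (x - y) powr (2 * s - real DIM('a)) \<le> 1" if "1 \<le> norm (x - y)"
    using powr_mono[of "2 * s - real DIM('a)" 0 "norm (x - y)"] that assms by (auto split: if_splits)
  then show ?thesis
    by (auto simp: far_form_density_def far_pairs_def indicator_def abs_mult intro!: mult_left_le_one_le)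
qed

lemma integrable_lborel_square_tensor:
  fixes u :: "'a::euclidean_space \<Rightarrow> real"
  assumes "integrable lborel u"
  shows "integrable lborel (\<lambda>(x, y). u x * u y)"
  by (rule integrable.intros[OF has_bochner_integral_lborel_times[OF assms assms]])

lemma integrable_far_form_density:
  fixes u :: "'a::euclidean_space \<Rightarrow> real"
  assumes u: "integrable lborel u" and s: "2 * s \<le> real DIM('a)"
  shows "integrable lborel (far_form_density s u)"
  by (rule Bochner_Integration.integrable_bound[OF integrable_lborel_square_tensor[OF u]])
     (use borel_measurable_integrable[OF u] far_form_density_measurable[of u s] far_form_density_le[OF s, of u] in auto)

lemma tendsto_far_form:
  fixes u :: "'a::euclidean_space \<Rightarrow> real"
  assumes u: "integrable lborel u" and s: "\<And>n. 2 * s n \<le> real DIM('a)" "s \<longlonglongrightarrow> 0"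
  shows "(\<lambda>n. LINT p|lborel. far_form_density (s n) u p) \<longlonglongrightarrow> (LINT p|lborel. far_form_density 0 u p)"
proof (rule integral_dominated_convergence)
  have [measurable]: "u \<in> borel_measurable borel" using u by simp
  show "far_form_density 0 u \<in> borel_measurable lborel" "far_form_density (s n) u \<in> borel_measurable lborel" for n
    by (simp_all only: far_form_density_measurable[OF \<open>u \<in> borel_measurable borel\<close>])
  show "integrable lborel (\<lambda>p. norm (case p of (x, y) \<Rightarrow> u x * u y))"
    by (intro integrable_norm integrable_lborel_square_tensor u)
  show "AE p in lborel. norm (far_form_density (s n) u p) \<le> norm (case p of (x, y) \<Rightarrow> u x * u y)" for n
    using far_form_density_le[OF s(1), where u = u] by auto
  have "(\<lambda>n. far_form_density (s n) u p) \<longlonglongrightarrow> far_form_density 0 u p" for p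
  proof (cases "p \<in> far_pairs")
    case True
    obtain x y where p: "p = (x, y)" by (cases p)
    have "norm (x - y) \<noteq> 0" using True by (auto simp: p far_pairs_def)
    then have "(\<lambda>n. norm (x - y) powr (2 * s n - real DIM('a)) * (u x * u y))
        \<longlonglongrightarrow> norm (x - y) powr (2 * 0 - real DIM('a)) * (u x * u y)"
      by (intro tendsto_intros s) auto
    then show ?thesis using True by (simp add: far_form_density_def p)
  qed (simp add: far_form_density_def split_beta)
  then show "AE p in lborel. (\<lambda>n. far_form_density (s n) u p) \<longlonglongrightarrow> far_form_density 0 u p"
    by simp
qed

text \<open>
  On the near pairs write $u(x) u(y) = (u(x)^2 + u(y)^2)/2 - (u(x) - u(y))^2/2$. The squares give the
  mass $\omega_{N-1}/(2s)$ of the kernel near the diagonal, which is the part that blows up as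
  $s \to 0$; in the difference term $|x-y|^{2s-N} \le |x-y|^{-N}$ because $|x - y| \le 1$.
\<close>

lemma riesz_form_split:
  fixes u :: "'a::euclidean_space \<Rightarrow> real"
  assumes u: "integrable lborel u" and u2: "integrable lborel (\<lambda>x. (u x)\<^sup>2)"
    and E: "integrable lborel (near_energy_density u)"
    and s: "0 < s" "2 * s < real DIM('a)"
  shows "integrable lborel (\<lambda>(x, y). norm (x - y) powr (2 * s - real DIM('a)) * (u x * u y))" (is "integrable lborel ?f")
    and "(LINT (x, y)|lborel. norm (x - y) powr (2 * s - real DIM('a)) * (u x * u y))
      \<ge> omega_const TYPE('a) / (2 * s) * (LINT x|lborel. (u x)\<^sup>2) - (LINT p|lborel. near_energy_density u p) / 2
        + (LINT p|lborel. far_form_density s u p)" (is ?ge)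
proof -
  have [measurable]: "u \<in> borel_measurable borel" using u by simp
  define A where "A = (LINT x|lborel. (u x)\<^sup>2)"
  define k where "k z = indicator (cball 0 1) z * norm z powr (2 * s - real DIM('a))" for z :: 'a
  have k0: "k z \<ge> 0" for z by (simp add: k_def)
  have [measurable]: "cball (0::'a) 1 \<in> sets borel" by simp
  have [measurable]: "k \<in> borel_measurable borel" unfolding k_def[abs_def] by measurable
  have \<omega>: "omega_const TYPE('a) \<ge> 0"
    by (simp add: omega_const_eq_unit_ball_vol)
  have mass: "(\<integral>\<^sup>+z. ennreal (k z) \<partial>lborel) = ennreal (omega_const TYPE('a) / (2 * s))"
    using nn_integral_riesz_kernel_cball[OF s] by (simp add: k_def)
  note K = has_bochner_integral_diff_kernel[OF \<open>k \<in> _\<close> k0 mass _ u2]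
  \<comment> \<open>the two diagonal terms, each of mass $\frac{\omega_{N-1}}{2s} \|u\|^2$\<close>
  have sq: "has_bochner_integral lborel
      (\<lambda>p. ((case p of (x, y) \<Rightarrow> k (x - y) * (u x)\<^sup>2) + (case p of (x, y) \<Rightarrow> k (x - y) * (u y)\<^sup>2)) / 2)
      ((omega_const TYPE('a) / (2 * s) * A + omega_const TYPE('a) / (2 * s) * A) / 2)"
    (is "has_bochner_integral lborel ?sq _")
    unfolding A_def using \<omega> s by (intro has_bochner_integral_divide_zero has_bochner_integral_add K) simp_all
  define n where "n = (\<lambda>(x, y). k (x - y) * (u x * u y))"
  define d where "d = (\<lambda>(x, y). k (x - y) * (u x - u y)\<^sup>2)"
  have [measurable]: "n \<in> borel_measurable lborel" "d \<in> borel_measurable lborel"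
    unfolding n_def d_def lborel_prod[symmetric] by measurable
  have sq_eq: "?sq p = n p + d p / 2" for p
    by (cases p) (simp add: n_def d_def power2_diff field_simps)
  have d0: "d p \<ge> 0" for p by (auto simp: d_def k0 split: prod.split)
  have d_le: "d p \<le> near_energy_density u p" for p
  proof (cases p)
    case (Pair x y)
    show ?thesis
    proof (cases "norm (x - y) \<le> 1 \<and> x \<noteq> y")
      case True
      then have "norm (x - y) powr (2 * s - real DIM('a)) \<le> norm (x - y) powr (- real DIM('a))"
        using s by (intro powr_mono') auto
      also have "\<dots> = inverse (norm (x - y) ^ DIM('a))"
        using True by (simp add: powr_minus powr_realpow)
      finally have "norm (x - y) powr (2 * s - real DIM('a)) * (u x - u y)\<^sup>2 \<le> inverse (norm (x - y) ^ DIM('a)) * (u x - u y)\<^sup>2"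
        by (rule mult_right_mono) simp
      then show ?thesis
        using True by (simp add: Pair d_def k_def near_energy_density_def near_pairs_def divide_inverse mult.commute)
    next
      case False
      then show ?thesis
        by (auto simp: Pair d_def k_def near_energy_density_def near_pairs_def)
    qed
  qed
  have d: "integrable lborel d"
    by (rule Bochner_Integration.integrable_bound[OF E]) (use d0 d_le in \<open>auto intro!: AE_I2 order_trans[OF d_le]\<close>)
  have n: "integrable lborel n"
    using Bochner_Integration.integrable_diff[OF integrable.intros[OF sq] integrable_divide_zero[OF d, of 2]]
    unfolding sq_eq by simp
  have far: "integrable lborel (far_form_density s u)"
    using s by (intro integrable_far_form_density u) simp
  have f_M: "?f \<in> borel_measurable lborel"
    unfolding lborel_prod[symmetric] by measurable
  have f_eq: "AE p in lborel. n p + far_form_density s u p = ?f p"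
    using AE_lborel_dist_neq[of 1, where 'a='a]
  proof eventually_elim
    case (elim p)
    then show ?case
      by (cases p) (auto simp: n_def k_def far_form_density_def far_pairs_def indicator_def)
  qed
  have nf: "integrable lborel (\<lambda>p. n p + far_form_density s u p)"
    by (intro Bochner_Integration.integrable_add n far)
  show "integrable lborel ?f"
    by (rule integrable_cong_AE_imp[OF nf f_M f_eq])
  have "(LINT p|lborel. ?f p) = (LINT p|lborel. n p + far_form_density s u p)"
    by (rule integral_cong_AE[symmetric]) (use f_M f_eq nf in auto)
  also have "\<dots> = (LINT p|lborel. n p) + (LINT p|lborel. far_form_density s u p)"
    by (rule Bochner_Integration.integral_add[OF n far])
  also have "(LINT p|lborel. n p) = omega_const TYPE('a) / (2 * s) * A - (LINT p|lborel. d p) / 2"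
  proof -
    have "(LINT p|lborel. n p) + (LINT p|lborel. d p) / 2 = (LINT p|lborel. n p + d p / 2)"
      using n d by simp
    also have "\<dots> = omega_const TYPE('a) / (2 * s) * A"
      unfolding sq_eq[symmetric] has_bochner_integral_integral_eq[OF sq] by (simp add: mult.commute)
    finally show ?thesis by simp
  qed
  finally have "(LINT p|lborel. ?f p) = omega_const TYPE('a) / (2 * s) * A - (LINT p|lborel. d p) / 2
      + (LINT p|lborel. far_form_density s u p)" .
  moreover have "(LINT p|lborel. d p) \<le> (LINT p|lborel. near_energy_density u p)"
    by (rule integral_mono[OF d E]) (rule d_le)
  ultimately show ?ge
    by (simp add: A_def)
qed

lemma ennreal_sum_le: "ennreal (\<Sum>i\<in>I. a i) \<le> (\<Sum>i\<in>I. ennreal (a i))"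
proof -
  have "ennreal (\<Sum>i\<in>I. a i) \<le> ennreal (\<Sum>i\<in>I. max 0 (a i))"
    by (intro ennreal_leI sum_mono) simp
  also have "\<dots> = (\<Sum>i\<in>I. ennreal (max 0 (a i)))"
    by simp
  also have "\<dots> = (\<Sum>i\<in>I. ennreal (a i))"
    by (intro sum.cong refl) (simp add: max_def ennreal_neg)
  finally show ?thesis .
qed

section \<open>Summation over an orthonormal family\<close>

text \<open>
  The bathtub principle for the decreasing weight $|\xi|^{-p}$: among densities bounded by $V$, mass
  should sit in a ball. Comparison with an arbitrary level $R$ is enough, by
  $|\xi|^{-p} F \le R^{-p} F + V (|\xi|^{-p} - R^{-p})_+$.
\<close>

lemma bathtub_powr:
  fixes F :: "'a::euclidean_space \<Rightarrow> real"
  assumes [measurable]: "F \<in> borel_measurable borel" and F: "\<And>\<xi>. 0 \<le> F \<xi>" "\<And>\<xi>. F \<xi> \<le> V"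
    and mass: "(\<integral>\<^sup>+\<xi>. ennreal (F \<xi>) \<partial>lborel) \<le> ennreal B" and B: "B \<ge> 0"
    and p: "0 < p" "p < real DIM('a)" and R: "R > 0"
  shows "(\<integral>\<^sup>+\<xi>. ennreal (norm \<xi> powr (- p) * F \<xi>) \<partial>lborel)
     \<le> ennreal (R powr (- p) * B + V * (unit_ball_vol (real DIM('a)) * p * R powr (real DIM('a) - p) / (real DIM('a) - p)))"
proof -
  have [measurable]: "cball (0::'a) R \<in> sets borel" by simp
  have V: "V \<ge> 0" using F[of 0] by simp
  define g where "g \<xi> = indicator (cball 0 R) \<xi> * (norm \<xi> powr (- p) - R powr (- p))" for \<xi> :: 'a
  have [measurable]: "g \<in> borel_measurable borel" unfolding g_def[abs_def] by measurable
  have "(\<integral>\<^sup>+\<xi>. ennreal (norm \<xi> powr (- p) * F \<xi>) \<partial>lborel)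
      \<le> (\<integral>\<^sup>+\<xi>. ennreal (R powr (- p)) * ennreal (F \<xi>) + ennreal V * ennreal (g \<xi>) \<partial>lborel)"
  proof (rule nn_integral_mono)
    fix \<xi> :: 'a
    have "norm \<xi> powr (- p) * F \<xi> \<le> R powr (- p) * F \<xi> + V * max 0 (g \<xi>)"
    proof (cases "norm \<xi> powr (- p) \<le> R powr (- p)")
      case True
      then have "norm \<xi> powr (- p) * F \<xi> \<le> R powr (- p) * F \<xi>"
        by (rule mult_right_mono) (rule F)
      then show ?thesis using V by (simp add: add_increasing2)
    next
      case False
      then have "\<xi> \<noteq> 0" by auto
      have "norm \<xi> \<le> R"
      proof (rule ccontr)
        assume "\<not> norm \<xi> \<le> R"
        then have "norm \<xi> powr (- p) \<le> R powr (- p)"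
          using p R by (intro powr_mono2') auto
        with False show False by simp
      qed
      then have "(norm \<xi> powr (- p) - R powr (- p)) * F \<xi> \<le> max 0 (g \<xi>) * V"
        using False by (intro mult_mono) (auto simp: g_def F)
      then show ?thesis by (simp add: algebra_simps)
    qed
    then have "ennreal (norm \<xi> powr (- p) * F \<xi>) \<le> ennreal (R powr (- p) * F \<xi> + V * max 0 (g \<xi>))"
      by (rule ennreal_leI)
    also have "\<dots> = ennreal (R powr (- p)) * ennreal (F \<xi>) + ennreal V * ennreal (g \<xi>)"
      using V F by (simp add: ennreal_mult max_def ennreal_neg)
    finally show "ennreal (norm \<xi> powr (- p) * F \<xi>)
      \<le> ennreal (R powr (- p)) * ennreal (F \<xi>) + ennreal V * ennreal (g \<xi>)" .
  qed
  also have "\<dots> = ennreal (R powr (- p)) * (\<integral>\<^sup>+\<xi>. ennreal (F \<xi>) \<partial>lborel) + ennreal V * (\<integral>\<^sup>+\<xi>. ennreal (g \<xi>) \<partial>lborel)"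
    by (simp add: nn_integral_add nn_integral_cmult)
  also have "\<dots> \<le> ennreal (R powr (- p)) * ennreal B + ennreal V *
      ennreal (unit_ball_vol (real DIM('a)) * p * R powr (real DIM('a) - p) / (real DIM('a) - p))"
    unfolding g_def nn_integral_cball_powr_diff[OF p R]
    by (intro add_mono mult_left_mono mass) simp_all
  also have "\<dots> = ennreal (R powr (- p) * B + V * (unit_ball_vol (real DIM('a)) * p * R powr (real DIM('a) - p) / (real DIM('a) - p)))"
    using V B p by (simp add: ennreal_mult del: times_divide_eq_right)
  finally show ?thesis .
qed

text \<open>
  Bessel's inequality (the hypothesis with $V$) bounds the summed spectrum pointwise and
  \<open>power_spectrum_mass_le\<close> bounds its mass, so the bathtub bound applies with $p = 2s$.
\<close>

lemma riesz_form_sum_le: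
  fixes u :: "'i \<Rightarrow> 'a::euclidean_space \<Rightarrow> real"
  assumes fin: "finite I"
    and u: "\<And>i. i \<in> I \<Longrightarrow> integrable lborel (u i)" "\<And>i. i \<in> I \<Longrightarrow> integrable lborel (\<lambda>x. (u i x)\<^sup>2)"
    and norm1: "\<And>i. i \<in> I \<Longrightarrow> (LINT x|lborel. (u i x)\<^sup>2) = 1"
    and bessel: "\<And>\<xi>. (\<Sum>i\<in>I. power_spectrum (u i) \<xi>) \<le> V"
    and s: "0 < s" "2 * s < real DIM('a)" and R: "R > 0"
    and int: "\<And>i. i \<in> I \<Longrightarrow> integrable lborel (\<lambda>(x, y). norm (x - y) powr (2 * s - real DIM('a)) * (u i x * u i y))"
  shows "riesz_const TYPE('a) s * (\<Sum>i\<in>I. LINT (x, y)|lborel. norm (x - y) powr (2 * s - real DIM('a)) * (u i x * u i y))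
    \<le> Gamma s * (real (card I) * R powr (- 2 * s)
        + V / (2 * pi) ^ DIM('a) * (unit_ball_vol (real DIM('a)) * (2 * s) * R powr (real DIM('a) - 2 * s) / (real DIM('a) - 2 * s)))"
    (is "?C * (\<Sum>i\<in>I. ?U i) \<le> ?r")
proof -
  have [measurable]: "u i \<in> borel_measurable borel" if "i \<in> I" for i using u(1)[OF that] by simp
  define P where "P = (2 * pi) ^ DIM('a)"
  have P: "P > 0" by (simp add: P_def)
  have G: "Gamma s > 0" using s by (simp add: Gamma_real_pos)
  define F where "F \<xi> = (\<Sum>i\<in>I. power_spectrum (u i) \<xi>)" for \<xi>
  have F0: "F \<xi> \<ge> 0" for \<xi> by (simp add: F_def sum_nonneg power_spectrum_nonneg)
  have V: "V \<ge> 0" using order_trans[OF F0 bessel[of 0, folded F_def]] .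
  have [measurable]: "F \<in> borel_measurable borel" unfolding F_def[abs_def] by measurable
  have mass: "(\<integral>\<^sup>+\<xi>. ennreal (F \<xi>) \<partial>lborel) \<le> ennreal (P * real (card I))"
  proof -
    have "(\<integral>\<^sup>+\<xi>. ennreal (F \<xi>) \<partial>lborel) = (\<Sum>i\<in>I. \<integral>\<^sup>+\<xi>. ennreal (power_spectrum (u i) \<xi>) \<partial>lborel)"
      unfolding F_def by (subst nn_integral_sum[symmetric]) (auto simp: power_spectrum_nonneg)
    also have "\<dots> \<le> (\<Sum>i\<in>I. ennreal P)"
      using power_spectrum_mass_le[OF u] norm1 by (intro sum_mono) (simp add: P_def)
    also have "\<dots> = ennreal (P * real (card I))"
      using P by (simp add: ennreal_mult ennreal_of_nat_eq_real_of_nat mult.commute)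
    finally show ?thesis .
  qed
  have "ennreal (?C * (\<Sum>i\<in>I. ?U i)) \<le> (\<Sum>i\<in>I. ennreal (?C * ?U i))"
    unfolding sum_distrib_left by (rule ennreal_sum_le)
  also have "\<dots> = (\<Sum>i\<in>I. \<integral>\<^sup>+\<xi>. ennreal (Gamma s / P * norm \<xi> powr (- 2 * s) * power_spectrum (u i) \<xi>) \<partial>lborel)"
    unfolding P_def by (intro sum.cong refl riesz_form_eq_power_spectrum u s int)
  also have "\<dots> = (\<integral>\<^sup>+\<xi>. (\<Sum>i\<in>I. ennreal (Gamma s / P * norm \<xi> powr (- 2 * s) * power_spectrum (u i) \<xi>)) \<partial>lborel)"
    by (rule nn_integral_sum[symmetric]) simp
  also have "\<dots> = (\<integral>\<^sup>+\<xi>. ennreal (Gamma s / P) * ennreal (norm \<xi> powr (- (2 * s)) * F \<xi>) \<partial>lborel)"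
  proof (rule nn_integral_cong)
    fix \<xi>
    have "(\<Sum>i\<in>I. ennreal (Gamma s / P * norm \<xi> powr (- 2 * s) * power_spectrum (u i) \<xi>))
        = ennreal (\<Sum>i\<in>I. Gamma s / P * norm \<xi> powr (- 2 * s) * power_spectrum (u i) \<xi>)"
      by (rule sum_ennreal) (use G P in \<open>simp add: power_spectrum_nonneg\<close>)
    also have "(\<Sum>i\<in>I. Gamma s / P * norm \<xi> powr (- 2 * s) * power_spectrum (u i) \<xi>) = Gamma s / P * (norm \<xi> powr (- (2 * s)) * F \<xi>)"
      by (simp add: F_def sum_distrib_left mult.assoc)
    finally show "(\<Sum>i\<in>I. ennreal (Gamma s / P * norm \<xi> powr (- 2 * s) * power_spectrum (u i) \<xi>))
      = ennreal (Gamma s / P) * ennreal (norm \<xi> powr (- (2 * s)) * F \<xi>)"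
      using G P by (simp add: ennreal_mult' del: times_divide_eq_left)
  qed
  also have "\<dots> = ennreal (Gamma s / P) * (\<integral>\<^sup>+\<xi>. ennreal (norm \<xi> powr (- (2 * s)) * F \<xi>) \<partial>lborel)"
    by (rule nn_integral_cmult) simp
  also have "\<dots> \<le> ennreal (Gamma s / P) * ennreal (R powr (- (2 * s)) * (P * real (card I))
      + V * (unit_ball_vol (real DIM('a)) * (2 * s) * R powr (real DIM('a) - 2 * s) / (real DIM('a) - 2 * s)))"
    using s R P bessel by (intro mult_left_mono bathtub_powr mass) (auto simp: F0, auto simp: F_def)
  also have "\<dots> = ennreal ?r"
  proof -
    have eq: "Gamma s * (c * a + V / P * b) = Gamma s / P * (a * (P * c) + V * b)" for a b c
      using P by (simp add: field_simps)
    have e: "- (2 * s) = - 2 * s" by simp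
    show ?thesis
      unfolding P_def[symmetric] eq e by (rule ennreal_mult'[symmetric]) (use G P in simp)
  qed
  finally have "ennreal (?C * (\<Sum>i\<in>I. ?U i)) \<le> ennreal ?r" .
  moreover have "?r \<ge> 0"
    using G V s by (intro mult_nonneg_nonneg add_nonneg_nonneg) auto
  ultimately show ?thesis
    by (simp add: ennreal_le_iff)
qed

section \<open>The limit of vanishing order\<close>

text \<open>
  The constant $\rho_N$ of the logarithmic Laplacian collects the logarithmic derivatives at $s = 0$ of
  $4^{-s}$ and $\Gamma(N/2 - s)$ on the physical side and of $\Gamma(1 + s)$ on the frequency side.
\<close>

lemma has_derivative_riesz_normalisation:
  fixes R :: real
  assumes R: "R > 0"
  defines "h \<equiv> \<lambda>s. riesz_const TYPE('a::euclidean_space) s * omega_const TYPE('a) / 2 - Gamma (1 + s) * R powr (- 2 * s)"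
  shows "h 0 = 0" and "(h has_real_derivative (2 * ln R - rho_const TYPE('a))) (at 0)"
proof -
  define n where "n = real DIM('a) / 2"
  have n: "n > 0" by (simp add: n_def)
  have Gn: "Gamma n > 0" using n by (rule Gamma_real_pos)
  have [simp]: "n \<notin> \<int>\<^sub>\<le>\<^sub>0" using n by (auto dest: nonpos_Ints_nonpos)
  have \<omega>: "riesz_const TYPE('a) s * omega_const TYPE('a) / 2 = exp (- s * ln 4) * Gamma (n - s) / Gamma n" for s
    by (simp add: riesz_const_def omega_const_eq n_def powr_minus powr_def[of 4] exp_minus field_simps)
  have h: "h s = exp (- s * ln 4) * Gamma (n - s) / Gamma n - Gamma (1 + s) * exp (- 2 * s * ln R)" for s
    unfolding h_def \<omega> using R by (simp add: powr_def)
  show "h 0 = 0" using Gn by (simp add: h)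
  have "((\<lambda>s. Gamma (n - s)) has_real_derivative (Gamma (n - 0) * Digamma (n - 0)) * (- 1)) (at 0)"
    by (rule DERIV_chain2[where f = Gamma]) (auto intro!: derivative_eq_intros)
  moreover have "((\<lambda>s::real. Gamma (1 + s)) has_real_derivative (Gamma (1 + 0) * Digamma (1 + 0)) * 1) (at 0)"
    by (rule DERIV_chain2[where f = Gamma]) (auto intro!: derivative_eq_intros)
  ultimately have "(h has_real_derivative
      ((exp (- 0 * ln 4) * (- ln 4)) * Gamma (n - 0) + (Gamma (n - 0) * Digamma (n - 0) * (- 1)) * exp (- 0 * ln 4)) / Gamma n
      - ((Gamma (1 + 0) * Digamma (1 + 0) * 1) * exp (- 2 * 0 * ln R) + (exp (- 2 * 0 * ln R) * (- 2 * ln R)) * Gamma (1 + 0))) (at 0)"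
    unfolding h[abs_def]
    by (intro DERIV_diff DERIV_cdivide DERIV_mult) (auto intro!: derivative_eq_intros)
  moreover have "ln 4 = 2 * ln (2::real)"
    using ln_realpow[of 2 2] by simp
  then have "((exp (- 0 * ln 4) * (- ln 4)) * Gamma (n - 0) + (Gamma (n - 0) * Digamma (n - 0) * (- 1)) * exp (- 0 * ln 4)) / Gamma n
      - ((Gamma (1 + 0) * Digamma (1 + 0) * 1) * exp (- 2 * 0 * ln R) + (exp (- 2 * 0 * ln R) * (- 2 * ln R)) * Gamma (1 + 0))
      = 2 * ln R - rho_const TYPE('a)"
    using Gn by (simp add: rho_const_def n_def[symmetric] field_simps)
  ultimately show "(h has_real_derivative (2 * ln R - rho_const TYPE('a))) (at 0)"
    by (simp only:)
qed

text \<open>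
  The combination of the two bounds for the Riesz form: after the terms of order
  $1/s$ have been collected into the difference quotient \<open>h s / s\<close>, every remaining term converges as
  $s \to 0$.
\<close>

lemma logarithmic_form_sum_ge:
  fixes u :: "'i \<Rightarrow> 'a::euclidean_space \<Rightarrow> real"
  assumes fin: "finite I"
    and u: "\<And>i. i \<in> I \<Longrightarrow> integrable lborel (u i)" "\<And>i. i \<in> I \<Longrightarrow> integrable lborel (\<lambda>x. (u i x)\<^sup>2)"
    and norm1: "\<And>i. i \<in> I \<Longrightarrow> (LINT x|lborel. (u i x)\<^sup>2) = 1"
    and E: "\<And>i. i \<in> I \<Longrightarrow> integrable lborel (near_energy_density (u i))"
    and bessel: "\<And>\<xi>. (\<Sum>i\<in>I. power_spectrum (u i) \<xi>) \<le> V"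
    and R: "R > 0"
  shows "(\<Sum>i\<in>I. c_const TYPE('a) / 2 * (LINT p|lborel. near_energy_density (u i) p)
        - c_const TYPE('a) * (LINT p|lborel. far_form_density 0 (u i) p) + rho_const TYPE('a))
     \<ge> 2 * real (card I) * ln R - d_const TYPE('a) * V * R ^ DIM('a)"
proof -
  define N where "N = real DIM('a)"
  have N: "N \<ge> 1" by (simp add: N_def Suc_leI)
  define v where "v = unit_ball_vol N"
  define P where "P = (2 * pi) ^ DIM('a)"
  have P: "P > 0" by (simp add: P_def)
  define k where "k = real (card I)"
  define r where "r = riesz_const TYPE('a)"
  define EE where "EE = (\<Sum>i\<in>I. LINT p|lborel. near_energy_density (u i) p)"
  define FF where "FF s = (\<Sum>i\<in>I. LINT p|lborel. far_form_density s (u i) p)" for s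
  define h where "h s = r s * omega_const TYPE('a) / 2 - Gamma (1 + s) * R powr (- 2 * s)" for s
  have h: "h 0 = 0" "(h has_real_derivative (2 * ln R - rho_const TYPE('a))) (at 0)"
    unfolding h_def[abs_def] r_def by (rule has_derivative_riesz_normalisation[OF R])+
  \<comment> \<open>all terms of order $1/s$ are collected in the difference quotient of \<open>h\<close> at $0$\<close>
  have ineq: "k * (h s / s) - Gamma (1 + s) * (V / P * (v * 2 * R powr (N - 2 * s) / (N - 2 * s)))
      \<le> r s * (EE / 2 - FF s)" if s: "0 < s" "2 * s < N" for s
  proof -
    define U where "U i = (LINT (x, y)|lborel. norm (x - y) powr (2 * s - real DIM('a)) * (u i x * u i y))" for i
    have s': "2 * s < real DIM('a)" using s by (simp add: N_def)
    have "(\<Sum>i\<in>I. omega_const TYPE('a) / (2 * s) - (LINT p|lborel. near_energy_density (u i) p) / 2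
        + (LINT p|lborel. far_form_density s (u i) p)) \<le> (\<Sum>i\<in>I. U i)"
      using riesz_form_split(2)[OF u E s(1) s'] norm1 by (intro sum_mono) (simp add: U_def)
    then have "k * (omega_const TYPE('a) / (2 * s)) - EE / 2 + FF s \<le> (\<Sum>i\<in>I. U i)"
      by (simp add: sum.distrib sum_subtractf EE_def FF_def k_def sum_divide_distrib)
    moreover have r0: "r s > 0"
      using s' by (simp add: r_def riesz_const_def Gamma_real_pos)
    ultimately have "r s * (k * (omega_const TYPE('a) / (2 * s)) - EE / 2 + FF s) \<le> r s * (\<Sum>i\<in>I. U i)"
      by (simp add: mult_left_mono)
    also have "\<dots> \<le> Gamma s * (k * R powr (- 2 * s) + V / P * (v * (2 * s) * R powr (N - 2 * s) / (N - 2 * s)))"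
      unfolding r_def U_def k_def P_def v_def N_def
      by (rule riesz_form_sum_le[OF fin u norm1 bessel s(1) s' R]) (assumption | rule riesz_form_split(1)[OF u E s(1) s'])+
    also have "Gamma s = Gamma (1 + s) / s"
    proof -
      have "s \<notin> \<int>\<^sub>\<le>\<^sub>0" using s by (auto dest: nonpos_Ints_nonpos)
      then show ?thesis using s Gamma_plus1[of s] by (simp add: add.commute)
    qed
    also have "Gamma (1 + s) / s * (k * R powr (- 2 * s) + V / P * (v * (2 * s) * R powr (N - 2 * s) / (N - 2 * s)))
      = k * (Gamma (1 + s) * R powr (- 2 * s) / s) + Gamma (1 + s) * (V / P * (v * 2 * R powr (N - 2 * s) / (N - 2 * s)))"
      using s by (simp add: field_simps)
    finally have le: "r s * (k * (omega_const TYPE('a) / (2 * s)) - EE / 2 + FF s)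
      \<le> k * (Gamma (1 + s) * R powr (- 2 * s) / s) + Gamma (1 + s) * (V / P * (v * 2 * R powr (N - 2 * s) / (N - 2 * s)))" .
    have h_s: "k * (h s / s) = r s * (k * (omega_const TYPE('a) / (2 * s))) - k * (Gamma (1 + s) * R powr (- 2 * s) / s)"
      using s by (simp add: h_def diff_divide_distrib right_diff_distrib)
    have rearrange: "y - b \<le> q * (e - f)" if "q * (x - e + f) \<le> a + b" "y = q * x - a" for a b e f q x y :: real
      using that by (simp add: algebra_simps)
    show ?thesis
      by (rule rearrange[OF le h_s])
  qed
  \<comment> \<open>the factor $1/4$ keeps $2 s_n < 1 \<le> N$\<close>
  define s where "s n = inverse (real (Suc n)) / 4" for n
  have s0: "s n > 0" for n by (simp add: s_def)
  have s2: "2 * s n < N" for n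
  proof -
    have "inverse (real (Suc n)) \<le> 1" by (simp add: inverse_le_1_iff)
    then show ?thesis using N by (simp add: s_def)
  qed
  have s_lim: "s \<longlonglongrightarrow> 0"
    unfolding s_def using tendsto_divide[OF LIMSEQ_inverse_real_of_nat tendsto_const, of 4] by simp
  have s_at: "filterlim s (at 0) sequentially"
    unfolding filterlim_at using s_lim s0 by (auto intro!: always_eventually simp: less_imp_neq[symmetric])
  have h_lim: "(\<lambda>n. h (s n) / s n) \<longlonglongrightarrow> 2 * ln R - rho_const TYPE('a)"
    using filterlim_compose[OF h(2)[unfolded DERIV_def] s_at] by (simp add: h(1))
  have G_lim: "(\<lambda>n. Gamma (1 + s n)) \<longlonglongrightarrow> Gamma (1 + 0)"
    by (intro tendsto_intros s_lim) auto
  have r_lim: "(\<lambda>n. r (s n)) \<longlonglongrightarrow> c_const TYPE('a)"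
  proof -
    have "real DIM('a) / 2 - 0 \<notin> \<int>\<^sub>\<le>\<^sub>0" by (auto dest: nonpos_Ints_nonpos simp: not_le)
    then have "(\<lambda>n. r (s n)) \<longlonglongrightarrow> pi powr (- real DIM('a) / 2) * 4 powr (- 0) * Gamma (real DIM('a) / 2 - 0)"
      unfolding r_def riesz_const_def by (intro tendsto_intros s_lim) auto
    then show ?thesis by (simp add: c_const_def)
  qed
  have F_lim: "(\<lambda>n. FF (s n)) \<longlonglongrightarrow> FF 0"
    unfolding FF_def using s2 by (intro tendsto_sum tendsto_far_form u s_lim) (auto simp: N_def less_imp_le)
  have left: "(\<lambda>n. k * (h (s n) / s n) - Gamma (1 + s n) * (V / P * (v * 2 * R powr (N - 2 * s n) / (N - 2 * s n))))
      \<longlonglongrightarrow> k * (2 * ln R - rho_const TYPE('a)) - Gamma (1 + 0) * (V / P * (v * 2 * R powr (N - 2 * 0) / (N - 2 * 0)))"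
    using R N by (intro tendsto_intros h_lim G_lim s_lim) auto
  have right: "(\<lambda>n. r (s n) * (EE / 2 - FF (s n))) \<longlonglongrightarrow> c_const TYPE('a) * (EE / 2 - FF 0)"
    by (intro tendsto_intros r_lim F_lim)
  have limit: "k * (2 * ln R - rho_const TYPE('a)) - Gamma (1 + 0) * (V / P * (v * 2 * R powr (N - 2 * 0) / (N - 2 * 0)))
      \<le> c_const TYPE('a) * (EE / 2 - FF 0)"
    by (rule LIMSEQ_le[OF left right]) (use ineq s0 s2 in auto)
  have d: "V / P * (v * 2 * R powr N / N) = d_const TYPE('a) * V * R ^ DIM('a)"
    using R N by (simp add: d_const_def omega_const_eq_unit_ball_vol v_def N_def P_def powr_realpow power2_eq_square mult_ac)
  have sum_eq: "(\<Sum>i\<in>I. c_const TYPE('a) / 2 * (LINT p|lborel. near_energy_density (u i) p)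
        - c_const TYPE('a) * (LINT p|lborel. far_form_density 0 (u i) p) + rho_const TYPE('a))
      = c_const TYPE('a) * (EE / 2 - FF 0) + k * rho_const TYPE('a)"
    unfolding sum.distrib sum_subtractf sum_distrib_left[symmetric] EE_def FF_def k_def
    by (simp add: right_diff_distrib)
  show ?thesis
    unfolding sum_eq using limit d by (simp add: k_def right_diff_distrib mult_ac)
qed

section \<open>From eigenfunctions to a bound for eigenvalue sums\<close>

lemma bessel_inequality:
  fixes u :: "'i \<Rightarrow> 'x \<Rightarrow> real"
  assumes fin: "finite I"
    and uu: "\<And>i j. i \<in> I \<Longrightarrow> j \<in> I \<Longrightarrow> integrable M (\<lambda>x. u i x * u j x)"
    and fu: "\<And>i. i \<in> I \<Longrightarrow> integrable M (\<lambda>x. f x * u i x)"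
    and ff: "integrable M (\<lambda>x. (f x)\<^sup>2)"
    and orth: "\<And>i j. i \<in> I \<Longrightarrow> j \<in> I \<Longrightarrow> (LINT x|M. u i x * u j x) = (if i = j then 1 else 0)"
  shows "(\<Sum>i\<in>I. (LINT x|M. f x * u i x)\<^sup>2) \<le> (LINT x|M. (f x)\<^sup>2)"
proof -
  define c where "c i = (LINT x|M. f x * u i x)" for i
  have eq: "(f x - (\<Sum>i\<in>I. c i * u i x))\<^sup>2
      = (f x)\<^sup>2 - (\<Sum>i\<in>I. 2 * c i * (f x * u i x)) + (\<Sum>i\<in>I. \<Sum>j\<in>I. c i * c j * (u i x * u j x))" for x
  proof -
    define S where "S = (\<Sum>i\<in>I. c i * u i x)"
    have "(\<Sum>i\<in>I. 2 * c i * (f x * u i x)) = 2 * f x * S"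
      by (simp add: S_def sum_distrib_left mult_ac)
    moreover have "(\<Sum>i\<in>I. \<Sum>j\<in>I. c i * c j * (u i x * u j x)) = S\<^sup>2"
      by (simp add: S_def power2_eq_square sum_product mult_ac)
    ultimately show ?thesis
      by (simp add: power2_diff S_def)
  qed
  have "0 \<le> (LINT x|M. (f x - (\<Sum>i\<in>I. c i * u i x))\<^sup>2)"
    by simp
  also have "\<dots> = (LINT x|M. (f x)\<^sup>2) - (\<Sum>i\<in>I. 2 * c i * c i)
      + (\<Sum>i\<in>I. \<Sum>j\<in>I. c i * c j * (if i = j then 1 else 0))"
    unfolding eq using uu fu ff
    by (simp add: c_def orth Bochner_Integration.integral_sum Bochner_Integration.integrable_sum
        integrable_mult_right cong: sum.cong)
  also have "\<dots> = (LINT x|M. (f x)\<^sup>2) - (\<Sum>i\<in>I. (c i)\<^sup>2)"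
    using fin by (simp add: sum.delta if_distrib power2_eq_square mult.assoc flip: sum_distrib_left cong: if_cong)
  finally show ?thesis by (simp add: c_def)
qed

text \<open>
  Bessel's inequality for the functions $\cos(\xi \cdot x)$ and $\sin(\xi \cdot x)$ on $\Omega$, whose squared
  norms add up to $|\Omega|$.
\<close>

lemma power_spectrum_sum_le:
  fixes u :: "'i \<Rightarrow> 'a::euclidean_space \<Rightarrow> real"
  assumes fin: "finite I"
    and \<Omega>: "\<Omega> \<in> sets borel" "emeasure lborel \<Omega> < \<infinity>"
    and u: "\<And>i. i \<in> I \<Longrightarrow> integrable lborel (u i)" "\<And>i. i \<in> I \<Longrightarrow> integrable lborel (\<lambda>x. (u i x)\<^sup>2)"
    and supp: "\<And>i x. i \<in> I \<Longrightarrow> x \<notin> \<Omega> \<Longrightarrow> u i x = 0"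
    and orth: "\<And>i j. i \<in> I \<Longrightarrow> j \<in> I \<Longrightarrow> (LINT x|lborel. u i x * u j x) = (if i = j then 1 else 0)"
  shows "(\<Sum>i\<in>I. power_spectrum (u i) \<xi>) \<le> measure lborel \<Omega>"
proof -
  have [measurable]: "u i \<in> borel_measurable borel" if "i \<in> I" for i using u(1)[OF that] by simp
  have [measurable]: "\<Omega> \<in> sets borel" by fact
  have uu: "integrable lborel (\<lambda>x. u i x * u j x)" if "i \<in> I" "j \<in> I" for i j
  proof (rule Bochner_Integration.integrable_bound)
    show "integrable lborel (\<lambda>x. (u i x)\<^sup>2 + (u j x)\<^sup>2)"
      using that u by simp
    have "\<bar>u i x * u j x\<bar> \<le> (u i x)\<^sup>2 + (u j x)\<^sup>2" for x
    proof -
      have "0 \<le> \<bar>u i x\<bar> * \<bar>u j x\<bar>" by simp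
      then show ?thesis
        using sum_squares_bound[of "\<bar>u i x\<bar>" "\<bar>u j x\<bar>"] unfolding abs_mult power2_abs by linarith
    qed
    then show "AE x in lborel. norm (u i x * u j x) \<le> norm ((u i x)\<^sup>2 + (u j x)\<^sup>2)" by auto
  qed (use that in measurable)
  have ind: "integrable lborel (indicator \<Omega> :: 'a \<Rightarrow> real)"
    using \<Omega> by (intro integrable_real_indicator) auto
  have B: "integrable lborel (\<lambda>x. (indicator \<Omega> x * g x)\<^sup>2)"
      "(\<Sum>i\<in>I. (LINT x|lborel. u i x * g x)\<^sup>2) \<le> (LINT x|lborel. (indicator \<Omega> x * g x)\<^sup>2)"
    if [measurable]: "g \<in> borel_measurable borel" and g: "\<And>x. \<bar>g x\<bar> \<le> 1" for g :: "'a \<Rightarrow> real"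
  proof -
    show ff: "integrable lborel (\<lambda>x. (indicator \<Omega> x * g x)\<^sup>2)"
      by (rule Bochner_Integration.integrable_bound[OF ind])
         (use g in \<open>auto simp: indicator_def abs_square_le_1\<close>)
    have eq: "indicator \<Omega> x * g x * u i x = u i x * g x" if "i \<in> I" for i x
      using supp[OF that, of x] by (auto simp: indicator_def)
    have fu: "integrable lborel (\<lambda>x. indicator \<Omega> x * g x * u i x)" if "i \<in> I" for i
      by (rule Bochner_Integration.integrable_bound[OF u(1)[OF that]])
         (use g that in \<open>auto simp: indicator_def abs_mult intro!: mult_left_le_one_le\<close>)
    have "(\<Sum>i\<in>I. (LINT x|lborel. indicator \<Omega> x * g x * u i x)\<^sup>2) \<le> (LINT x|lborel. (indicator \<Omega> x * g x)\<^sup>2)"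
      by (rule bessel_inequality[OF fin uu fu ff orth])
    then show "(\<Sum>i\<in>I. (LINT x|lborel. u i x * g x)\<^sup>2) \<le> (LINT x|lborel. (indicator \<Omega> x * g x)\<^sup>2)"
      by (simp add: eq cong: sum.cong)
  qed
  have c: "(\<lambda>x::'a. cos (\<xi> \<bullet> x)) \<in> borel_measurable borel" "\<bar>cos (\<xi> \<bullet> x)\<bar> \<le> 1"
    and s: "(\<lambda>x::'a. sin (\<xi> \<bullet> x)) \<in> borel_measurable borel" "\<bar>sin (\<xi> \<bullet> x)\<bar> \<le> 1" for x
    by simp_all
  have "(\<Sum>i\<in>I. power_spectrum (u i) \<xi>)
      \<le> (LINT x|lborel. (indicator \<Omega> x * cos (\<xi> \<bullet> x))\<^sup>2) + (LINT x|lborel. (indicator \<Omega> x * sin (\<xi> \<bullet> x))\<^sup>2)"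
    unfolding power_spectrum_def sum.distrib by (intro add_mono B c s)
  also have "\<dots> = (LINT x|lborel. (indicator \<Omega> x * cos (\<xi> \<bullet> x))\<^sup>2 + (indicator \<Omega> x * sin (\<xi> \<bullet> x))\<^sup>2)"
    by (intro Bochner_Integration.integral_add[symmetric] B c s)
  also have "\<dots> = (LINT x|lborel. indicator \<Omega> x)"
    by (intro Bochner_Integration.integral_cong) (auto simp: indicator_def)
  also have "\<dots> = measure lborel \<Omega>"
    by simp
  finally show ?thesis .
qed

lemma AE_lborel_pair_both:
  assumes "AE x in (lborel :: 'a::euclidean_space measure). P x"
  shows "AE (x, y) in (lborel :: ('a \<times> 'a) measure). P x \<and> P y"
proof -
  obtain N where N: "N \<in> null_sets lborel" "{x \<in> space lborel. \<not> P x} \<subseteq> N"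
    using assms unfolding eventually_ae_filter by blast
  then have [measurable]: "N \<in> sets borel" by auto
  have "AE p in (lborel :: 'a measure) \<Otimes>\<^sub>M (lborel :: 'a measure). fst p \<notin> N \<and> snd p \<notin> N"
  proof (rule lborel_pair.AE_pair_measure)
    show "AE x in lborel. AE y in lborel. fst (x, y) \<notin> N \<and> snd (x, y) \<notin> N"
      using AE_not_in[OF N(1)] by eventually_elim (use AE_not_in[OF N(1)] in simp)
  qed measurable
  then have "AE p in (lborel :: ('a \<times> 'a) measure). fst p \<notin> N \<and> snd p \<notin> N"
    unfolding lborel_prod .
  then show ?thesis
    by eventually_elim (use N(2) in auto)
qed

lemma integral_lebesgue_cong_AE_lborel:
  fixes f g :: "'a::euclidean_space \<Rightarrow> real"
  assumes g: "g \<in> borel_measurable lborel" and eq: "AE x in lborel. f x = g x"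
  shows "(LINT x|lebesgue. f x) = (LINT x|lborel. g x)"
    and "integrable lebesgue f \<longleftrightarrow> integrable lborel g"
proof -
  have g': "g \<in> borel_measurable lebesgue" using g by (rule measurable_completion)
  have eq': "AE x in lebesgue. f x = g x" using eq by (rule AE_completion)
  have f': "f \<in> borel_measurable lebesgue"
    by (rule borel_measurable_AE[OF g']) (use eq' in eventually_elim, simp)
  show "(LINT x|lebesgue. f x) = (LINT x|lborel. g x)"
    using integral_cong_AE[OF f' g' eq'] integral_completion[OF g] by simp
  show "integrable lebesgue f \<longleftrightarrow> integrable lborel g"
    using integrable_cong_AE[OF f' g' eq'] integrable_completion[OF g] by simp
qed

lemma H_space_borel_representative:
  fixes \<phi> :: "'a::euclidean_space \<Rightarrow> real"
  assumes "\<phi> \<in> H_space \<Omega>" and [measurable]: "\<Omega> \<in> sets borel"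
  obtains u where "u \<in> borel_measurable borel" "AE x in lborel. \<phi> x = u x" "\<And>x. x \<notin> \<Omega> \<Longrightarrow> u x = 0"
proof -
  from assms(1) have "\<phi> \<in> borel_measurable lebesgue" and supp: "\<And>x. x \<notin> \<Omega> \<Longrightarrow> \<phi> x = 0"
    by (auto simp: H_space_def)
  then obtain u where [measurable]: "u \<in> borel_measurable borel" and u: "AE x in lborel. \<phi> x = u x"
    using completion_ex_borel_measurable_real[of \<phi> lborel] by auto
  show ?thesis
  proof
    show "(\<lambda>x. indicator \<Omega> x * u x) \<in> borel_measurable borel" by measurable
    show "AE x in lborel. \<phi> x = indicator \<Omega> x * u x"
      using u by eventually_elim (use supp in \<open>auto simp: indicator_def\<close>)
  qed simp
qed

text \<open>
  Eigenfunctions are only Lebesgue measurable, whereas Fubini's theorem is applied to Borel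
  functions. Passing to a Borel representative changes neither the energy nor the form.
\<close>

lemma EL_form_borel_representative:
  fixes \<phi> u :: "'a::euclidean_space \<Rightarrow> real"
  assumes \<phi>: "\<phi> \<in> H_space \<Omega>" and [measurable]: "u \<in> borel_measurable borel" and eq: "AE x in lborel. \<phi> x = u x"
  shows "integrable lborel (near_energy_density u)"
    and "EL_form \<phi> \<phi> = c_const TYPE('a) / 2 * (LINT p|lborel. near_energy_density u p)
      - c_const TYPE('a) * (LINT p|lborel. far_form_density 0 u p) + rho_const TYPE('a) * (LINT x|lborel. (u x)\<^sup>2)"
proof -
  have [measurable]: "near_pairs \<in> sets ((lborel :: 'a measure) \<Otimes>\<^sub>M lborel)"
    by (simp only: lborel_prod near_pairs_measurable)
  have near_M: "near_energy_density u \<in> borel_measurable lborel"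
    unfolding near_energy_density_def split_beta prod.collapse lborel_prod[symmetric] by measurable
  have far_M: "far_form_density 0 u \<in> borel_measurable lborel"
    by (rule far_form_density_measurable) simp
  have near_eq: "AE p in lborel. indicator near_pairs p * (case p of (x, y) \<Rightarrow> (\<phi> x - \<phi> y) * (\<phi> x - \<phi> y) / norm (x - y) ^ DIM('a))
      = near_energy_density u p"
    using AE_lborel_pair_both[OF eq] by eventually_elim (auto simp: near_energy_density_def power2_eq_square)
  have far_eq: "AE p in lborel. indicator far_pairs p * (case p of (x, y) \<Rightarrow> \<phi> x * \<phi> y / norm (x - y) ^ DIM('a))
      = far_form_density 0 u p"
    using AE_lborel_pair_both[OF eq]
  proof eventually_elim
    case (elim p)
    obtain x y where p: "p = (x, y)" by (cases p)
    have "norm (x - y) powr (2 * 0 - real DIM('a)) = inverse (norm (x - y) ^ DIM('a))" if "p \<in> far_pairs"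
      using that by (simp add: p far_pairs_def powr_minus powr_realpow')
    then show ?case
      using elim by (auto simp: p far_form_density_def indicator_def divide_inverse mult.commute)
  qed
  have sq_eq: "AE x in lborel. \<phi> x * \<phi> x = (u x)\<^sup>2"
    using eq by eventually_elim (simp add: power2_eq_square)
  show "EL_form \<phi> \<phi> = c_const TYPE('a) / 2 * (LINT p|lborel. near_energy_density u p)
      - c_const TYPE('a) * (LINT p|lborel. far_form_density 0 u p) + rho_const TYPE('a) * (LINT x|lborel. (u x)\<^sup>2)"
    unfolding EL_form_def E_form_def set_lebesgue_integral_def real_scaleR_def
      integral_lebesgue_cong_AE_lborel(1)[OF near_M near_eq] integral_lebesgue_cong_AE_lborel(1)[OF far_M far_eq]
    by (subst integral_lebesgue_cong_AE_lborel(1)[OF _ sq_eq]) simp_all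
  show "integrable lborel (near_energy_density u)"
  proof (rule integrableI_bounded[OF near_M])
    have "(\<integral>\<^sup>+p. ennreal (norm (near_energy_density u p)) \<partial>lborel)
        = (\<integral>\<^sup>+p. (case p of (x, y) \<Rightarrow> ennreal ((\<phi> x - \<phi> y)\<^sup>2 / norm (x - y) ^ DIM('a))) * indicator near_pairs p \<partial>lborel)"
      by (rule nn_integral_cong_AE, use near_eq in eventually_elim)
         (auto simp: near_energy_density_def indicator_def power2_eq_square split: prod.split)
    also have "\<dots> < \<infinity>"
      using \<phi> by (simp add: H_space_def nn_integral_completion)
    finally show "(\<integral>\<^sup>+p. ennreal (norm (near_energy_density u p)) \<partial>lborel) < \<infinity>" .
  qed
qed

text \<open>
  An eigenvalue is the value of the quadratic form at its normalised eigenfunction.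
\<close>

lemma eigenvalue_sum_ge:
  fixes \<Omega> :: "'a::euclidean_space set"
  assumes \<Omega>: "open \<Omega>" "bounded \<Omega>" and lam: "dirichlet_eigenvalues \<Omega> lam" and R: "R > 0"
  shows "(\<Sum>i=1..k. lam i) \<ge> 2 * real k * ln R - d_const TYPE('a) * measure lebesgue \<Omega> * R ^ DIM('a)"
proof -
  have [measurable]: "\<Omega> \<in> sets borel" using \<Omega>(1) by simp
  have \<Omega>_fin: "emeasure lborel \<Omega> < \<infinity>" by (rule emeasure_bounded_finite) fact
  from lam obtain \<phi> where eigen: "\<And>i. i \<ge> 1 \<Longrightarrow> is_eigenfunction \<Omega> (lam i) (\<phi> i)"
    and basis: "L2_orthonormal_basis \<Omega> \<phi>"
    by (auto simp: dirichlet_eigenvalues_def)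
  have H: "\<phi> i \<in> H_space \<Omega>" if "i \<ge> 1" for i using eigen[OF that] by (simp add: is_eigenfunction_def)
  have L2: "\<phi> i \<in> L2_space \<Omega>" if "i \<ge> 1" for i using basis that by (simp add: L2_orthonormal_basis_def)
  have orth: "L2_inner \<Omega> (\<phi> i) (\<phi> j) = (if i = j then 1 else 0)" if "i \<ge> 1" "j \<ge> 1" for i j
    using basis that by (simp add: L2_orthonormal_basis_def)
  have "\<exists>u. i \<ge> 1 \<longrightarrow> u \<in> borel_measurable borel \<and> (AE x in lborel. \<phi> i x = u x) \<and> (\<forall>x. x \<notin> \<Omega> \<longrightarrow> u x = 0)" for i
    using H_space_borel_representative[OF H, of i] by (metis \<open>\<Omega> \<in> sets borel\<close>)
  then obtain u where u_M: "\<And>i. i \<ge> 1 \<Longrightarrow> u i \<in> borel_measurable borel"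
    and u_eq: "\<And>i. i \<ge> 1 \<Longrightarrow> AE x in lborel. \<phi> i x = u i x"
    and u_supp: "\<And>i x. i \<ge> 1 \<Longrightarrow> x \<notin> \<Omega> \<Longrightarrow> u i x = 0"
    by metis
  have u_orth: "(LINT x|lborel. u i x * u j x) = (if i = j then 1 else 0)" if i: "i \<ge> 1" and j: "j \<ge> 1" for i j
  proof -
    have "AE x in lborel. indicator \<Omega> x * (\<phi> i x * \<phi> j x) = u i x * u j x"
      using u_eq[OF i] u_eq[OF j] by eventually_elim (use u_supp[OF i] in \<open>auto simp: indicator_def\<close>)
    then have "(LINT x|lebesgue. indicator \<Omega> x * (\<phi> i x * \<phi> j x)) = (LINT x|lborel. u i x * u j x)"
      using u_M[OF i] u_M[OF j] by (intro integral_lebesgue_cong_AE_lborel) auto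
    then show ?thesis
      using orth[OF i j] by (simp add: L2_inner_def set_lebesgue_integral_def)
  qed
  have u_sq: "integrable lborel (\<lambda>x. (u i x)\<^sup>2)" if i: "i \<ge> 1" for i
  proof -
    have eq: "AE x in lborel. (\<phi> i x)\<^sup>2 = (u i x)\<^sup>2" using u_eq[OF i] by eventually_elim simp
    have M: "(\<lambda>x. (u i x)\<^sup>2) \<in> borel_measurable lborel" using u_M[OF i] by simp
    have "integrable lebesgue (\<lambda>x. (\<phi> i x)\<^sup>2)" using L2[OF i] by (simp add: L2_space_def)
    then show ?thesis using integral_lebesgue_cong_AE_lborel(2)[OF M eq] by simp
  qed
  have u_int: "integrable lborel (u i)" if i: "i \<ge> 1" for i
  proof (rule Bochner_Integration.integrable_bound)
    show "integrable lborel (\<lambda>x. (u i x)\<^sup>2 + indicator \<Omega> x)"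
      using u_sq[OF i] \<Omega>_fin by (intro Bochner_Integration.integrable_add integrable_real_indicator) auto
    \<comment> \<open>square integrable functions on a set of finite measure are integrable\<close>
    have "\<bar>u i x\<bar> \<le> (u i x)\<^sup>2 + indicator \<Omega> x" for x
      using u_supp[OF i, of x] sum_squares_bound[of "\<bar>u i x\<bar>" 1] by (cases "x \<in> \<Omega>") auto
    then show "AE x in lborel. norm (u i x) \<le> norm ((u i x)\<^sup>2 + indicator \<Omega> x)" by auto
  qed (use u_M[OF i] in simp)
  have u_norm: "(LINT x|lborel. (u i x)\<^sup>2) = 1" if "i \<ge> 1" for i
    using u_orth[OF that that] by (simp add: power2_eq_square)
  have lam_eq: "lam i = c_const TYPE('a) / 2 * (LINT p|lborel. near_energy_density (u i) p)
      - c_const TYPE('a) * (LINT p|lborel. far_form_density 0 (u i) p) + rho_const TYPE('a)" if i: "i \<ge> 1" for i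
  proof -
    have "EL_form (\<phi> i) (\<phi> i) = lam i * L2_inner \<Omega> (\<phi> i) (\<phi> i)"
      using eigen[OF i] H[OF i] by (simp add: is_eigenfunction_def L2_inner_def)
    then show ?thesis
      using EL_form_borel_representative(2)[OF H[OF i] u_M[OF i] u_eq[OF i]] orth[OF i i] u_norm[OF i] by simp
  qed
  have "2 * real (card {1..k}) * ln R - d_const TYPE('a) * measure lborel \<Omega> * R ^ DIM('a)
     \<le> (\<Sum>i=1..k. c_const TYPE('a) / 2 * (LINT p|lborel. near_energy_density (u i) p)
        - c_const TYPE('a) * (LINT p|lborel. far_form_density 0 (u i) p) + rho_const TYPE('a))"
    by (rule logarithmic_form_sum_ge)
       (auto intro!: u_int u_sq u_norm R power_spectrum_sum_le \<Omega>_fin u_supp u_orth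
          EL_form_borel_representative(1)[OF H u_M u_eq])
  also have "\<dots> = (\<Sum>i=1..k. lam i)"
    by (intro sum.cong refl) (simp add: lam_eq)
  finally show ?thesis by simp
qed

lemma d_const_pos: "d_const TYPE('a::euclidean_space) > 0"
  by (simp add: d_const_def omega_const_eq_unit_ball_vol)

lemma measure_lebesgue_open_pos:
  fixes \<Omega> :: "'a::euclidean_space set"
  assumes "open \<Omega>" "\<Omega> \<noteq> {}" "bounded \<Omega>"
  shows "measure lebesgue \<Omega> > 0"
proof -
  have "\<Omega> \<in> lmeasurable"
    using assms by (intro lmeasurable_open)
  then have "measure lebesgue \<Omega> \<noteq> 0"
    using open_not_negligible[OF assms(1,2)] by (simp add: negligible_iff_measure0)
  then show ?thesis
    by (simp add: zero_less_measure_iff)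
qed

text \<open>
  The bound of \<open>eigenvalue_sum_ge\<close> is largest for $R^N = 2k / (N d_N |\Omega|)$.
\<close>

lemma eigenvalue_sum_ge_ln:
  fixes \<Omega> :: "'a::euclidean_space set"
  assumes \<Omega>: "open \<Omega>" "\<Omega> \<noteq> {}" "bounded \<Omega>" and lam: "dirichlet_eigenvalues \<Omega> lam" and k: "k \<ge> 1"
  shows "(\<Sum>i=1..k. lam i) \<ge> 2 * real k / real DIM('a) *
      ln (2 * real k / (exp 1 * real DIM('a) * d_const TYPE('a) * measure lebesgue \<Omega>))"
proof -
  define a where "a = real DIM('a) * d_const TYPE('a) * measure lebesgue \<Omega>"
  have "measure lebesgue \<Omega> > 0"
    by (rule measure_lebesgue_open_pos) fact+
  then have a: "a > 0"
    using d_const_pos[where 'a='a] by (simp add: a_def)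
  define R where "R = (2 * real k / a) powr (1 / real DIM('a))"
  have q: "2 * real k / a > 0" using a k by simp
  have R: "R > 0" using a k by (simp add: R_def)
  have "R ^ DIM('a) = 2 * real k / a"
    unfolding powr_realpow[OF R, symmetric] using a by (simp add: R_def powr_powr)
  moreover have "ln R = ln (2 * real k / a) / real DIM('a)"
    using q by (simp add: R_def ln_powr)
  moreover have "d_const TYPE('a) * measure lebesgue \<Omega> = a / real DIM('a)"
    by (simp add: a_def)
  moreover have "ln (2 * real k / (exp 1 * a)) = ln (2 * real k / a) - 1"
    using a k ln_div[of "2 * real k / a" "exp 1"] by (simp add: mult.commute)
  ultimately show ?thesis
    using eigenvalue_sum_ge[OF \<Omega>(1,3) lam R, of k] a
    by (simp add: a_def[symmetric] mult.assoc right_diff_distrib)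
qed

theorem theorem1p2:
  fixes \<Omega> :: "'a::euclidean_space set" and lam :: "nat \<Rightarrow> real"
  assumes "open \<Omega>" and "connected \<Omega>" and "\<Omega> \<noteq> {}" and "bounded \<Omega>"
    and "dirichlet_eigenvalues \<Omega> lam"
  shows
    "(\<forall>k::nat. k \<ge> 1 \<longrightarrow>
        (\<Sum>i=1..k. lam i) \<ge> - d_const TYPE('a) * measure lebesgue \<Omega>) \<and>
     (\<forall>k::nat. real k > exp 1 * real DIM('a) * d_const TYPE('a) / 2 * measure lebesgue \<Omega> \<longrightarrow>
        (\<Sum>i=1..k. lam i) > 0) \<and>
     (\<forall>k::nat. real k \<ge> exp (exp 1 + 1) * real DIM('a) * d_const TYPE('a) / 2 * measure lebesgue \<Omega> \<longrightarrow>
        (\<Sum>i=1..k. lam i) \<ge> 2 * real k / real DIM('a) *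
          (ln (real k)
           + ln (2 / (exp 1 * real DIM('a) * d_const TYPE('a) * measure lebesgue \<Omega>))
           - ln (ln (2 * real k / (exp 1 * real DIM('a) * d_const TYPE('a) * measure lebesgue \<Omega>)))))"
proof -
  define N where "N = real DIM('a)"
  define d where "d = d_const TYPE('a)"
  define m where "m = measure lebesgue \<Omega>"
  have N: "N > 0" by (simp add: N_def)
  have d: "d > 0" unfolding d_def by (rule d_const_pos)
  have m: "m > 0" unfolding m_def by (rule measure_lebesgue_open_pos) (use assms in auto)
  have a: "exp 1 * N * d * m > 0" using N d m by simp
  \<comment> \<open>the lower bounds on $k$ in (ii) and (iii) are positive, so they exclude $k = 0$\<close>
  have pos_index: "k \<ge> 1" if "real k \<ge> c * N * d / 2 * m" "c > 0" for k c
  proof (rule ccontr)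
    assume "\<not> k \<ge> 1"
    moreover have "c * N * d / 2 * m > 0" using that N d m by simp
    ultimately show False using that by simp
  qed
  have ge_ln: "(\<Sum>i=1..k. lam i) \<ge> 2 * real k / N * ln (2 * real k / (exp 1 * N * d * m))" if "k \<ge> 1" for k
    using eigenvalue_sum_ge_ln[OF assms(1,3,4,5) that] by (simp add: N_def d_def m_def)
  show ?thesis
    unfolding N_def[symmetric] d_def[symmetric] m_def[symmetric]
  proof (intro conjI allI impI)
    fix k :: nat
    show "- d * m \<le> (\<Sum>i=1..k. lam i)"
      using eigenvalue_sum_ge[OF assms(1,4,5), of 1 k] by (simp add: d_def m_def)
  next
    fix k :: nat
    assume k: "exp 1 * N * d / 2 * m < real k"
    then have "k \<ge> 1" using pos_index[of "exp 1" k] by simp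
    have "1 < 2 * real k / (exp 1 * N * d * m)"
      using k a by (simp add: less_divide_eq)
    then have "0 < 2 * real k / N * ln (2 * real k / (exp 1 * N * d * m))"
      using N \<open>k \<ge> 1\<close> by (intro mult_pos_pos) auto
    also have "\<dots> \<le> (\<Sum>i=1..k. lam i)"
      by (rule ge_ln) fact
    finally show "0 < (\<Sum>i=1..k. lam i)" .
  next
    fix k :: nat
    assume k: "exp (exp 1 + 1) * N * d / 2 * m \<le> real k"
    define y where "y = 2 * real k / (exp 1 * N * d * m)"
    have "k \<ge> 1" using k pos_index[of "exp (exp 1 + 1)" k] by simp
    have y: "exp (exp 1) \<le> y"
      using k a by (simp add: y_def le_divide_eq exp_add mult_ac)
    have "y > 0"
      using less_le_trans[OF exp_gt_zero y] .
    then have "exp 1 \<le> ln y"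
      using y by (simp add: ln_ge_iff)
    then have "ln (ln y) \<ge> 0"
      using exp_ge_add_one_self[of 1] by (intro ln_ge_zero) simp
    moreover have "ln (real k) + ln (2 / (exp 1 * N * d * m)) = ln y"
      using a \<open>k \<ge> 1\<close> by (subst ln_mult_pos[symmetric]) (simp_all add: y_def mult.commute)
    ultimately have "2 * real k / N * (ln (real k) + ln (2 / (exp 1 * N * d * m)) - ln (ln y))
        \<le> 2 * real k / N * ln y"
      using N by (intro mult_left_mono) auto
    also have "\<dots> \<le> (\<Sum>i=1..k. lam i)"
      unfolding y_def by (rule ge_ln) fact
    finally show "2 * real k / N * (ln (real k) + ln (2 / (exp 1 * N * d * m))
        - ln (ln (2 * real k / (exp 1 * N * d * m)))) \<le> (\<Sum>i=1..k. lam i)"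
      unfolding y_def .
  qed
qed

end
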